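(* Let $d\ge 2$ be an integer, let $\theta>0$ be a real number such that $(d-1)\theta<2\pi/3$, and let $\eta_d=\sin\frac{\theta}{2}\cos\frac{(d-1)\theta}{2}$. Let $0\le\eta<\eta_d$ be real. Then there exists a constant $\gamma=\gamma(d,\eta)>0$ such that for every positive integer $n$ and every real $0<\epsilon<1$ there exists a polynomial $p=p_{d,\eta,\epsilon,n}$ in the entries of a $d$-dimensional $n\times\cdots\times n$ complex tensor $A=(a_{i_1\ldots i_d})$ such that $\deg p\le\gamma(\ln n-\ln\epsilon)$ and $$\left|\ln\operatorname{PER}A-p(A)\right|\le\epsilon$$ for all $d$-dimensional $n\times\cdots\times n$ complex tensors $A=(a_{i_1\ldots i_d})$ satisfying $|1-a_{i_1\ldots i_d}|\le\eta$ for all $1\le i_1,\dots,i_d\le n$.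
   Context: The permanent of a $d$-dimensional $n\times\cdots\times n$ array (tensor) $A=(a_{i_1\ldots i_d})$ of $n^d$ real or complex numbers is $$\operatorname{PER}A=\sum_{\sigma_2,\dots,\sigma_d\in S_n}\ \prod_{i=1}^n a_{i\,\sigma_2(i)\ldots\sigma_d(i)},$$ where $S_n$ is the symmetric group of permutations of $\{1,\dots,n\}$. Branch of the logarithm: let $D$ be the convex set of all $d$-dimensional $n\times\cdots\times n$ complex tensors $Z$ with $|1-z_{i_1\ldots i_d}|\le\eta_d$ for all indices. $\operatorname{PER}$ has no zeros on $D$, and $\ln\operatorname{PER}$ denotes the continuous branch on $D$ (a continuous function $L$ with $e^{L(Z)}=\operatorname{PER}Z$) which is real at real tensors; in particular its value at the all-ones tensor is the real number $(d-1)\ln n!$. *)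

theory Defs
  imports "HOL-Analysis.Analysis" "HOL-Library.Poly_Mapping" "HOL-Combinatorics.Permutations"
begin

text \<open>
  A \<open>d\<close>-dimensional \<open>n \<times> \<dots> \<times> n\<close> tensor is a function on index lists \<open>[i\<^sub>1, \<dots>, i\<^sub>d]\<close>, extensional
  outside the index set. The topology is the product topology on functions; since the other
  coordinates are frozen at \<open>undefined\<close>, it is the usual topology of \<open>n ^ d\<close> complex coordinates.
\<close>

definition tensor_indices :: "nat \<Rightarrow> nat \<Rightarrow> nat list set" where
  "tensor_indices d n = {is. length is = d \<and> set is \<subseteq> {1..n}}"

definition tensors :: "nat \<Rightarrow> nat \<Rightarrow> (nat list \<Rightarrow> complex) set" where
  "tensors d n = (tensor_indices d n \<rightarrow>\<^sub>E UNIV)"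

definition tensor_polydisc :: "nat \<Rightarrow> nat \<Rightarrow> real \<Rightarrow> (nat list \<Rightarrow> complex) set" where
  "tensor_polydisc d n r = {Z \<in> tensors d n. \<forall>is\<in>tensor_indices d n. norm (1 - Z is) \<le> r}"

text \<open>The list \<open>\<sigma>s\<close> is \<open>[\<sigma>\<^sub>2, \<dots>, \<sigma>\<^sub>d]\<close>.\<close>

definition PER :: "nat \<Rightarrow> nat \<Rightarrow> (nat list \<Rightarrow> complex) \<Rightarrow> complex" where
  "PER d n A =
     (\<Sum>\<sigma>s | length \<sigma>s = d - 1 \<and> (\<forall>\<sigma>\<in>set \<sigma>s. \<sigma> permutes {1..n}).
        \<Prod>i=1..n. A (i # map (\<lambda>\<sigma>. \<sigma> i) \<sigma>s))"

definition eta_bound :: "nat \<Rightarrow> real \<Rightarrow> real" where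
  "eta_bound d \<theta> = sin (\<theta> / 2) * cos ((real d - 1) * \<theta> / 2)"

definition is_ln_PER :: "nat \<Rightarrow> nat \<Rightarrow> real \<Rightarrow> ((nat list \<Rightarrow> complex) \<Rightarrow> complex) \<Rightarrow> bool" where
  "is_ln_PER d n r L \<longleftrightarrow>
     continuous_on (tensor_polydisc d n r) L \<and>
     (\<forall>Z\<in>tensor_polydisc d n r. exp (L Z) = PER d n Z) \<and>
     (\<forall>Z\<in>tensor_polydisc d n r. (\<forall>is\<in>tensor_indices d n. Z is \<in> \<real>) \<longrightarrow> L Z \<in> \<real>)"

text \<open>
  The branch of the logarithm of the permanent on the polydisc of radius \<open>r\<close>. Extensionality only
  fixes the irrelevant values outside the polydisc, so that the description is unique.
\<close>

definition ln_PER :: "nat \<Rightarrow> nat \<Rightarrow> real \<Rightarrow> (nat list \<Rightarrow> complex) \<Rightarrow> complex" where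
  "ln_PER d n r = (THE L. L \<in> extensional (tensor_polydisc d n r) \<and> is_ln_PER d n r L)"

text \<open>
  Multivariate polynomials with variables in \<open>'v\<close>: finitely supported maps from monomials
  (finitely supported exponent maps) to coefficients.
\<close>

type_synonym ('v, 'a) mpoly = "('v \<Rightarrow>\<^sub>0 nat) \<Rightarrow>\<^sub>0 'a"

definition mpoly_vars :: "('v, 'a::zero) mpoly \<Rightarrow> 'v set" where
  "mpoly_vars p = (\<Union>m\<in>Poly_Mapping.keys p. Poly_Mapping.keys m)"

definition mpoly_eval :: "('v, 'a::comm_semiring_1) mpoly \<Rightarrow> ('v \<Rightarrow> 'a) \<Rightarrow> 'a" where
  "mpoly_eval p x =
     (\<Sum>m\<in>Poly_Mapping.keys p. Poly_Mapping.lookup p m *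
        (\<Prod>v\<in>Poly_Mapping.keys m. x v ^ Poly_Mapping.lookup m v))"

text \<open>Total degree; the zero polynomial has degree \<open>0\<close>.\<close>

definition mpoly_degree :: "('v, 'a::zero) mpoly \<Rightarrow> nat" where
  "mpoly_degree p =
     Max (insert 0 ((\<lambda>m. \<Sum>v\<in>Poly_Mapping.keys m. Poly_Mapping.lookup m v) ` Poly_Mapping.keys p))"

end

theory Submission
  imports Defs "HOL-Complex_Analysis.Complex_Analysis"
begin

text \<open>
  Write \<open>J\<close> for the all-ones tensor and \<open>s = sin (\<theta>/2)\<close>.

  \<^bold>\<open>A sector argument.\<close> Expand the permanent along a slice, \<open>PER A = \<Sum>\<^sub>x a\<^sub>x u\<^sub>x\<close> with minors \<open>u\<^sub>x\<close>. Two
  minors differ in at most \<open>d - 1\<close> of the \<open>d\<close> coordinates, and by induction on the size each such change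
  turns the value by at most \<open>\<theta>\<close>. So the \<open>u\<^sub>x\<close> make pairwise angles at most \<open>\<alpha> = (d - 1) \<theta> < 2\<pi>/3\<close>;
  they lie in a common sector of opening \<open>\<alpha>\<close>, whence \<open>\<bar>\<Sum> u\<^sub>x\<bar> \<ge> cos (\<alpha>/2) \<Sum> \<bar>u\<^sub>x\<bar>\<close>
  (\<open>norm_sum_ge_of_pairwise_angle\<close>). Since \<open>\<bar>1 - a\<^sub>x\<bar> \<le> s cos (\<alpha>/2)\<close>, replacing the coefficients \<open>1\<close> by
  \<open>a\<^sub>x\<close> multiplies \<open>\<Sum> u\<^sub>x\<close> by some \<open>1 + w\<close> with \<open>\<bar>w\<bar> \<le> s < 1\<close>. Such a factor turns by at most \<open>\<theta>/2\<close>, so two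
  permanents that share these minors form an angle of at most \<open>\<theta>\<close>, which closes the induction
  (\<open>angle_invariant\<close>). The permanent therefore has no zeros, and filling one slice with ones changes it
  only by a factor in the disc of radius \<open>s\<close> about \<open>1\<close> (\<open>slice_ratio_near_1\<close>).

  \<^bold>\<open>The branch of the logarithm.\<close> Passing from \<open>J\<close> to \<open>A\<close> one slice at a time writes \<open>PER A / PER J\<close> as a
  product of \<open>n\<close> such factors, and the principal logarithm is continuous at each of them. Their sum
  \<open>ln_PER_sum\<close> is an explicit branch, given by one formula for all \<open>\<theta>\<close>. It is the only branch because
  two branches differ by a continuous function with values in \<open>2\<pi>\<i>\<int>\<close>, constant along the segment to
  \<open>J\<close> and zero at \<open>J\<close>. Moreover \<open>\<bar>ln_PER_sum A - ln (PER J)\<bar> \<le> n C\<close>, where \<open>C\<close> bounds \<open>\<bar>ln\<bar>\<close> on the disc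
  and depends on \<open>s\<close> alone.

  \<^bold>\<open>Interpolation.\<close> If \<open>\<bar>1 - a\<bar> \<le> \<eta>\<close> for all entries, then \<open>f(t) = ln (PER (J + t (A - J)))\<close> is holomorphic for
  \<open>\<bar>t\<bar> \<le> \<rho>\<close> with some \<open>\<rho> > 1\<close> depending on \<open>d\<close> and \<open>\<eta>\<close>. By Cauchy's estimate the Taylor polynomial of
  degree \<open>m\<close> at \<open>0\<close> is within \<open>n C / (\<rho>\<^sup>m (\<rho> - 1))\<close> of \<open>f(1) = ln (PER A)\<close>, so \<open>m = O(ln n - ln \<epsilon>)\<close> is enough
  (\<open>ln_PER_sum_taylor\<close>, \<open>exists_log_degree\<close>). The coefficient of \<open>t\<^sup>k\<close> in \<open>g(t) = PER (J + t (A - J))\<close> is a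
  polynomial of degree at most \<open>k\<close> in the entries of \<open>A\<close>; by the recursion that \<open>f' g = g'\<close> gives, and as
  \<open>g(0) = PER J\<close> is the same for all \<open>A\<close>, the Taylor coefficients of \<open>f\<close> have this property too
  (\<open>poly_fun_log_deriv_coeff\<close>).
\<close>

section \<open>Complex numbers in a common sector\<close>

text \<open>
  The angle enters as a real number \<open>t\<close> and not as a principal argument, so that angles add along a
  chain without reduction modulo \<open>2\<pi>\<close>.
\<close>

definition within_angle :: "real \<Rightarrow> complex \<Rightarrow> complex \<Rightarrow> bool" where
  "within_angle \<alpha> u v \<longleftrightarrow> (\<exists>r t. 0 < r \<and> \<bar>t\<bar> \<le> \<alpha> \<and> v = u * (of_real r * cis t))"

lemma within_angle_refl: "0 \<le> \<alpha> \<Longrightarrow> within_angle \<alpha> u u"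
  unfolding within_angle_def by (rule exI[of _ 1], rule exI[of _ 0]) auto

lemma within_angle_sym:
  assumes "within_angle \<alpha> u v"
  shows "within_angle \<alpha> v u"
proof -
  obtain r t where "0 < r" "\<bar>t\<bar> \<le> \<alpha>" "v = u * (of_real r * cis t)"
    using assms unfolding within_angle_def by blast
  then have "0 < inverse r \<and> \<bar>-t\<bar> \<le> \<alpha> \<and> u = v * (of_real (inverse r) * cis (-t))"
    by (auto simp: field_simps cis_mult simp flip: cis_inverse)
  then show ?thesis
    unfolding within_angle_def by blast
qed

lemma within_angle_trans:
  assumes "within_angle \<alpha> u v" "within_angle \<beta> v w"
  shows "within_angle (\<alpha> + \<beta>) u w"
proof -
  obtain r t where 1: "0 < r" "\<bar>t\<bar> \<le> \<alpha>" "v = u * (of_real r * cis t)"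
    using assms(1) unfolding within_angle_def by blast
  obtain r' t' where 2: "0 < r'" "\<bar>t'\<bar> \<le> \<beta>" "w = v * (of_real r' * cis t')"
    using assms(2) unfolding within_angle_def by blast
  have "0 < r * r' \<and> \<bar>t + t'\<bar> \<le> \<alpha> + \<beta> \<and> w = u * (of_real (r * r') * cis (t + t'))"
    using 1 2 by (auto simp: mult_ac simp flip: cis_mult)
  then show ?thesis
    unfolding within_angle_def by blast
qed

text \<open>
  Measured from one of the numbers, all directions lie in \<open>[-\<alpha>, \<alpha>]\<close>. Two of them differ by at most \<open>\<alpha>\<close>
  up to a multiple of \<open>2\<pi>\<close>, and that multiple is zero since the difference is at most
  \<open>2\<alpha> < 4\<pi>/3 < 2\<pi> - \<alpha>\<close>. So the directions fill an interval of length at most \<open>\<alpha>\<close>, and projecting onto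
  its bisector loses at most the factor \<open>cos (\<alpha>/2)\<close>. The cube roots of unity, whose sum vanishes, show
  that \<open>2\<pi>/3\<close> is the right threshold.
\<close>

lemma norm_sum_ge_of_pairwise_angle:
  fixes u :: "'i \<Rightarrow> complex"
  assumes X: "finite X" and \<alpha>: "0 \<le> \<alpha>" "\<alpha> < 2 * pi / 3"
    and ang: "\<And>x y. x \<in> X \<Longrightarrow> y \<in> X \<Longrightarrow> within_angle \<alpha> (u x) (u y)"
    and nz: "\<And>x. x \<in> X \<Longrightarrow> u x \<noteq> 0"
  shows "cos (\<alpha> / 2) * (\<Sum>x\<in>X. norm (u x)) \<le> norm (\<Sum>x\<in>X. u x)"
proof (cases "X = {}")
  case False
  then obtain o' where o': "o' \<in> X" by blast
  have "\<forall>x\<in>X. \<exists>r t. 0 < r \<and> \<bar>t\<bar> \<le> \<alpha> \<and> u x = u o' * (of_real r * cis t)"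
    using ang[OF o'] unfolding within_angle_def by blast
  then obtain r t where rt: "\<And>x. x \<in> X \<Longrightarrow> 0 < r x"
      "\<And>x. x \<in> X \<Longrightarrow> \<bar>t x\<bar> \<le> \<alpha>"
      "\<And>x. x \<in> X \<Longrightarrow> u x = u o' * (of_real (r x) * cis (t x))"
    by metis
  have t_diff: "t y - t x \<le> \<alpha>" if x: "x \<in> X" and y: "y \<in> X" for x y
  proof -
    obtain q s where q: "0 < q" "\<bar>s\<bar> \<le> \<alpha>" "u y = u x * (of_real q * cis s)"
      using ang[OF x y] unfolding within_angle_def by blast
    have "of_real (r y) * cis (t y) = of_real (r x * q) * cis (t x + s)"
      using q(3) rt(3)[OF x] rt(3)[OF y] nz[OF o'] by (simp add: mult_ac flip: cis_mult)
    moreover from this have "norm (of_real (r y) * cis (t y)) = norm (of_real (r x * q) * cis (t x + s))"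
      by simp
    then have "r y = r x * q"
      using rt(1)[OF x] rt(1)[OF y] q(1) by (simp add: norm_mult)
    ultimately have "cis (t y) = cis (t x + s)"
      using rt(1)[OF x] q(1) by simp
    then have "cis (t y - t x - s) = 1"
      by (metis cis_divide diff_diff_eq div_self cis_neq_zero)
    then have "cos (t y - t x - s) = 1"
      by (metis cis.simps(1) one_complex.simps(1))
    then obtain n :: int where n: "t y - t x - s = of_int n * 2 * pi"
      by (auto simp: cos_one_2pi_int)
    have "\<bar>of_int n * (2 * pi)\<bar> < 2 * pi"
      using n rt(2)[OF x] rt(2)[OF y] q(2) \<alpha> by (auto simp: mult.assoc)
    then have "\<bar>n\<bar> < 1"
      by (simp add: abs_mult)
    then show ?thesis
      using n q(2) by auto
  qed
  define m where "m = Min (t ` X)"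
  have m: "m \<in> t ` X" "\<And>x. x \<in> X \<Longrightarrow> m \<le> t x"
    using X False by (auto simp: m_def)
  define \<phi> where "\<phi> = m + \<alpha> / 2"
  have near: "\<bar>t x - \<phi>\<bar> \<le> \<alpha> / 2" if "x \<in> X" for x
  proof -
    have "t x - m \<le> \<alpha>"
      using m(1) that t_diff by blast
    then show ?thesis
      using m(2)[OF that] unfolding \<phi>_def by linarith
  qed
  \<comment> \<open>Multiplication by \<open>e\<close> turns the bisector of the sector onto the positive real axis.\<close>
  define e where "e = cis (-\<phi>) * cnj (sgn (u o'))"
  have "norm e = 1"
    using nz[OF o'] by (simp add: e_def norm_mult norm_sgn)
  have sgn: "u o' * cnj (sgn (u o')) = of_real (norm (u o'))"
    using nz[OF o'] by (simp add: sgn_eq complex_norm_square[symmetric] power2_eq_square)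
  have "cos (\<alpha> / 2) * norm (u x) \<le> Re (u x * e)" if x: "x \<in> X" for x
  proof -
    have "u x * e = (u o' * cnj (sgn (u o'))) * of_real (r x) * (cis (t x) * cis (-\<phi>))"
      unfolding rt(3)[OF x] e_def by (simp add: mult_ac)
    then have "u x * e = of_real (norm (u o')) * of_real (r x) * cis (t x - \<phi>)"
      unfolding sgn cis_mult by simp
    also have "\<dots> = of_real (norm (u x)) * cis (t x - \<phi>)"
      unfolding rt(3)[OF x] using rt(1)[OF x] by (simp add: norm_mult)
    finally have "Re (u x * e) = norm (u x) * cos \<bar>t x - \<phi>\<bar>"
      by (simp add: cos_abs_real)
    moreover have "cos (\<alpha> / 2) \<le> cos \<bar>t x - \<phi>\<bar>"
      using near[OF x] \<alpha> by (intro cos_monotone_0_pi_le) auto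
    ultimately show ?thesis
      by (simp add: mult.commute mult_left_mono)
  qed
  then have "cos (\<alpha> / 2) * (\<Sum>x\<in>X. norm (u x)) \<le> (\<Sum>x\<in>X. Re (u x * e))"
    by (simp add: sum_distrib_left sum_mono)
  also have "\<dots> = Re ((\<Sum>x\<in>X. u x) * e)"
    by (simp only: sum_distrib_right Re_sum)
  also have "\<dots> \<le> norm ((\<Sum>x\<in>X. u x) * e)"
    by (rule complex_Re_le_cmod)
  finally show ?thesis
    by (simp add: norm_mult \<open>norm e = 1\<close>)
qed auto

text \<open>
  The distance from \<open>1\<close> to the line through \<open>0\<close> and \<open>1 + w\<close> is \<open>\<bar>sin (Arg (1 + w))\<bar>\<close>, and it is at most the
  distance \<open>\<bar>w\<bar>\<close> from \<open>1\<close> to \<open>1 + w\<close>.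
\<close>

lemma within_angle_perturb:
  assumes w: "norm w \<le> sin \<phi>" and \<phi>: "0 \<le> \<phi>" "\<phi> < pi / 2"
  shows "within_angle \<phi> u (u * (1 + w))"
proof -
  define z where "z = 1 + w"
  have "sin \<phi> < 1"
    using \<phi> sin_monotone_2pi[of \<phi> "pi/2"] by auto
  have "Re z > 0"
    using w \<open>sin \<phi> < 1\<close> abs_Re_le_cmod[of w] by (auto simp: z_def)
  then have "z \<noteq> 0" by auto
  have t: "\<bar>Arg z\<bar> < pi / 2"
    using \<open>Re z > 0\<close> Arg_Re_pos by blast
  have z: "z = of_real (norm z) * cis (Arg z)"
    using Arg_eq[OF \<open>z \<noteq> 0\<close>] by (simp add: cis_conv_exp)
  have "w * cis (- Arg z) = z * cis (- Arg z) - cis (- Arg z)"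
    by (simp add: z_def algebra_simps)
  also have "z * cis (- Arg z) = of_real (norm z) * (cis (Arg z) * cis (- Arg z))"
    by (subst z) (simp add: mult.assoc)
  finally have "w * cis (- Arg z) = of_real (norm z) * (cis (Arg z) * cis (- Arg z)) - cis (- Arg z)" .
  then have "w * cis (- Arg z) = of_real (norm z) - cis (- Arg z)"
    by (simp add: cis_mult)
  then have "Im (w * cis (- Arg z)) = sin (Arg z)"
    by simp
  then have "\<bar>sin (Arg z)\<bar> \<le> sin \<phi>"
    using abs_Im_le_cmod[of "w * cis (- Arg z)"] w by (simp add: norm_mult)
  then have "sin (Arg z) \<le> sin \<phi>" "sin (- \<phi>) \<le> sin (Arg z)"
    by auto
  moreover have "- (pi / 2) < Arg z" "Arg z < pi / 2"
    using t by linarith+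
  ultimately have "\<bar>Arg z\<bar> \<le> \<phi>"
    using \<phi> sin_mono_le_eq[of "Arg z" \<phi>] sin_mono_le_eq[of "-\<phi>" "Arg z"] by (auto simp: abs_le_iff)
  with z \<open>z \<noteq> 0\<close> have "0 < norm z \<and> \<bar>Arg z\<bar> \<le> \<phi> \<and> u * (1 + w) = u * (of_real (norm z) * cis (Arg z))"
    by (simp add: z_def[symmetric])
  then show ?thesis
    unfolding within_angle_def by blast
qed

text \<open>
  The coefficients change the sum by at most \<open>s cos (\<alpha>/2) \<Sum> \<bar>u\<^sub>x\<bar>\<close>, and by the sector bound this is at most
  \<open>s \<bar>\<Sum> u\<^sub>x\<bar>\<close>: the factor \<open>cos (\<alpha>/2)\<close> in the bound on the coefficients pays for the cancellation.
\<close>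

lemma weighted_sum_sector:
  fixes u c :: "'i \<Rightarrow> complex"
  assumes X: "finite X" "X \<noteq> {}" and \<alpha>: "0 \<le> \<alpha>" "\<alpha> < 2 * pi / 3"
    and ang: "\<And>x y. x \<in> X \<Longrightarrow> y \<in> X \<Longrightarrow> within_angle \<alpha> (u x) (u y)"
    and nz: "\<And>x. x \<in> X \<Longrightarrow> u x \<noteq> 0"
    and c: "\<And>x. x \<in> X \<Longrightarrow> norm (1 - c x) \<le> s * cos (\<alpha> / 2)"
  shows "(\<Sum>x\<in>X. u x) \<noteq> 0"
    and "\<exists>w. norm w \<le> s \<and> (\<Sum>x\<in>X. c x * u x) = (\<Sum>x\<in>X. u x) * (1 + w)"
proof -
  define U where "U = (\<Sum>x\<in>X. u x)"
  have "cos (\<alpha> / 2) > 0"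
    using \<alpha> by (intro cos_gt_zero_pi) auto
  have "(\<Sum>x\<in>X. norm (u x)) > 0"
    using X nz by (intro sum_pos) auto
  have ge: "cos (\<alpha> / 2) * (\<Sum>x\<in>X. norm (u x)) \<le> norm U"
    unfolding U_def using norm_sum_ge_of_pairwise_angle[OF X(1) \<alpha> ang nz] .
  then show "(\<Sum>x\<in>X. u x) \<noteq> 0"
    using \<open>cos (\<alpha> / 2) > 0\<close> \<open>(\<Sum>x\<in>X. norm (u x)) > 0\<close>
    by (auto simp: U_def mult_le_0_iff)
  then have "U \<noteq> 0" by (simp add: U_def)
  obtain x0 where "x0 \<in> X" using X by blast
  then have "0 \<le> s * cos (\<alpha> / 2)"
    using c[of x0] norm_ge_zero[of "1 - c x0"] by linarith
  then have "0 \<le> s"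
    using \<open>cos (\<alpha> / 2) > 0\<close> by (simp add: zero_le_mult_iff)
  define w where "w = (\<Sum>x\<in>X. (c x - 1) * u x) / U"
  have "norm (\<Sum>x\<in>X. (c x - 1) * u x) \<le> (\<Sum>x\<in>X. (s * cos (\<alpha> / 2)) * norm (u x))"
    using c by (intro sum_norm_le) (simp add: norm_mult norm_minus_commute mult_right_mono)
  also have "\<dots> = s * (cos (\<alpha> / 2) * (\<Sum>x\<in>X. norm (u x)))"
    by (simp add: sum_distrib_left mult.assoc)
  also have "\<dots> \<le> s * norm U"
    using ge \<open>0 \<le> s\<close> by (rule mult_left_mono)
  finally have "norm w \<le> s"
    using \<open>U \<noteq> 0\<close> by (simp add: w_def norm_divide divide_le_eq)
  moreover have "(\<Sum>x\<in>X. c x * u x) = U * (1 + w)"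
    using \<open>U \<noteq> 0\<close> by (simp add: w_def distrib_left left_diff_distrib sum_subtractf flip: U_def)
  ultimately show "\<exists>w. norm w \<le> s \<and> (\<Sum>x\<in>X. c x * u x) = (\<Sum>x\<in>X. u x) * (1 + w)"
    unfolding U_def by blast
qed

section \<open>Permanents over boxes of index sets\<close>

text \<open>
  Letting each coordinate \<open>j < d\<close> range over its own index set \<open>S j\<close> makes every minor of a tensor a
  permanent of that same tensor over a smaller box, so that minors can be compared without
  renumbering the indices.
\<close>

definition index_box :: "nat \<Rightarrow> (nat \<Rightarrow> 'a set) \<Rightarrow> 'a list set" where
  "index_box d S = {x. length x = d \<and> (\<forall>j<d. x ! j \<in> S j)}"

text \<open>
  A tuple of permutations \<open>\<sigma>\<^sub>2, \<dots>, \<sigma>\<^sub>d\<close> is replaced by the set of index tuples that it selects. This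
  form treats all \<open>d\<close> coordinates alike, whereas the formula for \<open>PER\<close> singles out the first.
\<close>

definition matchings :: "nat \<Rightarrow> (nat \<Rightarrow> 'a set) \<Rightarrow> 'a list set set" where
  "matchings d S = {M. M \<subseteq> index_box d S \<and> (\<forall>j<d. bij_betw (\<lambda>x. x ! j) M (S j))}"

definition box_per :: "nat \<Rightarrow> (nat \<Rightarrow> 'a set) \<Rightarrow> ('a list \<Rightarrow> 'b::comm_semiring_1) \<Rightarrow> 'b" where
  "box_per d S A = (\<Sum>M\<in>matchings d S. \<Prod>x\<in>M. A x)"

abbreviation strike :: "(nat \<Rightarrow> 'a set) \<Rightarrow> (nat \<Rightarrow> 'a) \<Rightarrow> nat \<Rightarrow> 'a set" where
  "strike S f \<equiv> \<lambda>j. S j - {f j}"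

abbreviation slice :: "nat \<Rightarrow> (nat \<Rightarrow> 'a set) \<Rightarrow> nat \<Rightarrow> 'a \<Rightarrow> 'a list set" where
  "slice d S k a \<equiv> {x \<in> index_box d S. x ! k = a}"

lemma index_box_cong: "(\<And>j. j < d \<Longrightarrow> S j = T j) \<Longrightarrow> index_box d S = index_box d T"
  by (auto simp: index_box_def)

lemma matchings_cong:
  assumes "\<And>j. j < d \<Longrightarrow> S j = T j"
  shows "matchings d S = matchings d T"
  proof -
  have "index_box d S = index_box d T"
    using assms by (rule index_box_cong)
  then show ?thesis
    using assms by (simp add: matchings_def)
qed

lemma box_per_cong: "(\<And>j. j < d \<Longrightarrow> S j = T j) \<Longrightarrow> box_per d S A = box_per d T A"
  unfolding box_per_def using matchings_cong[of d S T] by simp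

lemma box_per_cong_entries: "(\<And>x. x \<in> index_box d S \<Longrightarrow> A x = B x) \<Longrightarrow> box_per d S A = box_per d S B"
  unfolding box_per_def by (intro sum.cong prod.cong) (auto simp: matchings_def)

lemma index_box_strike_subset: "index_box d (strike S f) \<subseteq> index_box d S"
  by (auto simp: index_box_def)

lemma finite_index_box:
  assumes "\<And>j. j < d \<Longrightarrow> finite (S j)"
  shows "finite (index_box d S)"
proof (rule finite_subset)
  show "index_box d S \<subseteq> {x. set x \<subseteq> (\<Union>j<d. S j) \<and> length x = d}"
    by (fastforce simp: index_box_def in_set_conv_nth)
qed (use assms in \<open>auto intro!: finite_lists_length_eq\<close>)

lemma finite_matchings:
  assumes "\<And>j. j < d \<Longrightarrow> finite (S j)"
  shows "finite (matchings d S)"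
  by (rule finite_subset[of _ "Pow (index_box d S)"]) (auto simp: matchings_def finite_index_box assms)

lemma slice_nonempty:
  assumes "k < d" "\<And>j. j < d \<Longrightarrow> S j \<noteq> {}" "a \<in> S k"
  shows "slice d S k a \<noteq> {}"
proof -
  have "\<forall>j. \<exists>y. j < d \<longrightarrow> y \<in> S j"
    using assms(2) by blast
  then obtain f where "\<And>j. j < d \<Longrightarrow> f j \<in> S j"
    by metis
  then have "map (f(k := a)) [0..<d] \<in> slice d S k a"
    using assms by (auto simp: index_box_def)
  then show ?thesis by blast
qed

lemma insert_mem_matchings:
  assumes x: "x \<in> index_box d S" and M: "M \<in> matchings d (strike S ((!) x))" and d: "0 < d"
  shows "x \<notin> M" "insert x M \<in> matchings d S"
proof -
  show "x \<notin> M"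
    using M d by (auto simp: matchings_def index_box_def)
  moreover have "bij_betw (\<lambda>y. y ! j) (insert x M) (S j)" if "j < d" for j
  proof -
    have "bij_betw (\<lambda>y. y ! j) (insert x M) (insert (x ! j) (S j - {x ! j}))"
      using M that \<open>x \<notin> M\<close> notIn_Un_bij_betw3[of x M "\<lambda>y. y ! j" "S j - {x ! j}"]
      by (auto simp: matchings_def)
    moreover have "x ! j \<in> S j"
      using x that by (simp add: index_box_def)
    ultimately show ?thesis
      by (simp add: insert_absorb)
  qed
  ultimately show "insert x M \<in> matchings d S"
    using x M index_box_strike_subset[of d S "(!) x"] by (auto simp: matchings_def)
qed

lemma remove_mem_matchings:
  assumes M: "M \<in> matchings d S" and x: "x \<in> M"
  shows "M - {x} \<in> matchings d (strike S ((!) x))"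
proof -
  have bij: "bij_betw (\<lambda>y. y ! j) (M - {x}) (S j - {x ! j})" if "j < d" for j
  proof (rule bij_betw_DiffI)
    show "bij_betw (\<lambda>y. y ! j) M (S j)"
      using M that by (simp add: matchings_def)
    then show "{x ! j} \<subseteq> S j" "{x} \<subseteq> M"
      using x by (auto dest: bij_betwE)
  qed auto
  moreover have "M - {x} \<subseteq> index_box d (strike S ((!) x))"
  proof
    fix y assume y: "y \<in> M - {x}"
    then have "length y = d"
      using M by (auto simp: matchings_def index_box_def)
    moreover have "y ! j \<in> S j - {x ! j}" if "j < d" for j
      using bij_betwE[OF bij[OF that]] y by blast
    ultimately show "y \<in> index_box d (strike S ((!) x))"
      by (simp add: index_box_def)
  qed
  ultimately show ?thesis
    by (simp add: matchings_def)
qed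

text \<open>
  Laplace expansion: a matching contains exactly one tuple whose coordinate \<open>k\<close> is \<open>a\<close>, and removing it
  leaves a matching of the box from which the coordinates of that tuple have been struck.
\<close>

lemma box_per_expand:
  assumes fin: "\<And>j. j < d \<Longrightarrow> finite (S j)" and k: "k < d" and a: "a \<in> S k"
  shows "box_per d S A = (\<Sum>x\<in>slice d S k a. A x * box_per d (strike S ((!) x)) A)"
proof -
  have d: "0 < d" using k by simp
  have finM: "finite M" if "M \<in> matchings d S" for M
    using that finite_subset[OF _ finite_index_box[OF fin]] by (auto simp: matchings_def)
  let ?D = "SIGMA x:slice d S k a. matchings d (strike S ((!) x))"
  let ?f = "\<lambda>(x, M). insert x M"
  have mem: "x \<in> index_box d S" "x ! k = a" "M \<in> matchings d (strike S ((!) x))"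
    "\<And>y. y \<in> M \<Longrightarrow> y ! k \<noteq> a" if "(x, M) \<in> ?D" for x M
    using that k by (auto simp: matchings_def index_box_def)
  have bij: "bij_betw ?f ?D (matchings d S)"
  proof (rule bij_betw_imageI)
    show "inj_on ?f ?D"
    proof (rule inj_onI)
      fix p q assume "p \<in> ?D" "q \<in> ?D" "?f p = ?f q"
      moreover obtain x M where p: "p = (x, M)" by fastforce
      moreover obtain y N where q: "q = (y, N)" by fastforce
      ultimately have *: "(x, M) \<in> ?D" "(y, N) \<in> ?D" "insert x M = insert y N" by auto
      have "x = y"
        using *(3) mem[OF *(1)] mem[OF *(2)] by (metis insert_iff)
      moreover have "x \<notin> M" "y \<notin> N"
        using mem[OF *(1)] mem[OF *(2)] by blast+
      ultimately have "M = N"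
        using *(3) by (metis insert_ident)
      with \<open>x = y\<close> show "p = q" by (simp add: p q)
    qed
    show "?f ` ?D = matchings d S"
    proof
      show "?f ` ?D \<subseteq> matchings d S"
        using insert_mem_matchings(2)[OF _ _ d] by auto
      show "matchings d S \<subseteq> ?f ` ?D"
      proof
        fix M assume M: "M \<in> matchings d S"
        then have "a \<in> (\<lambda>x. x ! k) ` M"
          using k a by (auto simp: matchings_def bij_betw_def)
        then obtain x where x: "x \<in> M" "x ! k = a" by blast
        then have "(x, M - {x}) \<in> ?D"
          using M remove_mem_matchings[OF M x(1)] by (auto simp: matchings_def)
        moreover have "M = ?f (x, M - {x})"
          using x by auto
        ultimately show "M \<in> ?f ` ?D" by (rule rev_image_eqI)
      qed
    qed
  qed
  have "box_per d S A = (\<Sum>p\<in>?D. \<Prod>y\<in>?f p. A y)"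
    unfolding box_per_def by (rule sum.reindex_bij_betw[OF bij, symmetric])
  also have "\<dots> = (\<Sum>(x, M)\<in>?D. A x * (\<Prod>y\<in>M. A y))"
  proof (rule sum.cong[OF refl], clarify)
    fix x M assume *: "x \<in> index_box d S" "M \<in> matchings d (strike S ((!) x))" "a = x ! k"
    note ins = insert_mem_matchings[OF *(1,2) d]
    show "(\<Prod>y\<in>insert x M. A y) = A x * (\<Prod>y\<in>M. A y)"
      using ins finM[OF ins(2)] by simp
  qed
  also have "\<dots> = (\<Sum>x\<in>slice d S k a. \<Sum>M\<in>matchings d (strike S ((!) x)). A x * (\<Prod>y\<in>M. A y))"
    by (rule sum.Sigma[symmetric]) (auto simp: finite_index_box fin finite_matchings)
  finally show ?thesis
    by (simp add: box_per_def sum_distrib_left)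
qed

section \<open>The zero-free region\<close>

text \<open>
  The coordinates of \<open>f\<close> are exchanged for those of \<open>g\<close> one at a time. As \<open>f\<close> and \<open>g\<close> agree at \<open>k\<close>, this takes
  at most \<open>d - 1\<close> steps. The hypothesis \<open>exch\<close> bounds the angle of one step: two boxes that agree outside
  coordinate \<open>m\<close>, where their sides \<open>insert a R\<close> and \<open>insert b R\<close> differ by one element.
\<close>

lemma within_angle_exchange_coords:
  fixes S :: "nat \<Rightarrow> 'a set" and A :: "'a list \<Rightarrow> complex"
  assumes \<theta>: "0 \<le> \<theta>" and kd: "k < d"
    and card: "\<And>j. j < d \<Longrightarrow> finite (S j) \<and> card (S j) = Suc n"
    and exch: "\<And>T m R a b. m < d \<Longrightarrow> (\<And>j. j < d \<Longrightarrow> j \<noteq> m \<Longrightarrow> finite (T j) \<and> card (T j) = n)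
        \<Longrightarrow> finite R \<Longrightarrow> Suc (card R) = n \<Longrightarrow> a \<notin> R \<Longrightarrow> b \<notin> R
        \<Longrightarrow> within_angle \<theta> (box_per d (T(m := insert a R)) A) (box_per d (T(m := insert b R)) A)"
    and f: "\<And>j. j < d \<Longrightarrow> f j \<in> S j" and g: "\<And>j. j < d \<Longrightarrow> g j \<in> S j" and k: "f k = g k"
  shows "within_angle ((real d - 1) * \<theta>) (box_per d (strike S f) A) (box_per d (strike S g) A)"
proof -
  \<comment> \<open>\<open>J\<close> is the set of coordinates already exchanged.\<close>
  define h where "h J = (\<lambda>j. if j \<in> J then g j else f j)" for J
  have hS: "h J j \<in> S j" if "j < d" for J j
    using f g that by (simp add: h_def)
  have chain: "within_angle (real (card J) * \<theta>) (box_per d (strike S f) A) (box_per d (strike S (h J)) A)"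
    if "finite J" "J \<subseteq> {..<d} - {k}" for J
    using that
  proof (induction J rule: finite_induct)
    case empty
    then show ?case
      by (simp add: h_def within_angle_refl)
  next
    case (insert m J)
    then have m: "m < d" "m \<notin> J" by auto
    have step: "within_angle \<theta> (box_per d (strike S (h J)) A) (box_per d (strike S (h (insert m J))) A)"
    proof (cases "f m = g m")
      case True
      then have "h (insert m J) = h J"
        by (auto simp: h_def)
      then show ?thesis
        using \<theta> by (simp add: within_angle_refl)
    next
      case False
      \<comment> \<open>At coordinate \<open>m\<close> the sides are \<open>S m - {f m} = insert (g m) R\<close> before the exchange and
          \<open>S m - {g m} = insert (f m) R\<close> after it.\<close>
      define R where "R = S m - {f m, g m}"
      define T where "T = strike S (h J)"
      have "card {f m, g m} = 2" "{f m, g m} \<subseteq> S m" "card (S m) = Suc n"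
        using False f g card m(1) by auto
      then have cR: "card R = Suc n - 2" and "2 \<le> Suc n"
        unfolding R_def using card[OF m(1)] card_mono[of "S m" "{f m, g m}"]
        by (auto simp: card_Diff_subset)
      have "within_angle \<theta> (box_per d (T(m := insert (g m) R)) A) (box_per d (T(m := insert (f m) R)) A)"
      proof (rule exch[OF m(1)])
        show "finite (T j) \<and> card (T j) = n" if "j < d" "j \<noteq> m" for j
          using card[OF that(1)] hS[OF that(1), of J] by (simp add: T_def)
        show "finite R"
          using card[OF m(1)] by (simp add: R_def)
        show "Suc (card R) = n"
          using cR \<open>2 \<le> Suc n\<close> by simp
      qed (auto simp: R_def)
      moreover have "T(m := insert (g m) R) = strike S (h J)"
        using False g[OF m(1)] m(2) by (auto simp: T_def R_def h_def fun_eq_iff)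
      moreover have "T(m := insert (f m) R) = strike S (h (insert m J))"
        using False f[OF m(1)] m(2) by (auto simp: T_def R_def h_def fun_eq_iff)
      ultimately show ?thesis by simp
    qed
    have "within_angle (real (card J) * \<theta> + \<theta>)
        (box_per d (strike S f) A) (box_per d (strike S (h (insert m J))) A)"
      using insert within_angle_trans[OF _ step] by auto
    then show ?case
      using insert by (simp add: algebra_simps)
  qed
  have "box_per d (strike S (h ({..<d} - {k}))) A = box_per d (strike S g) A"
    using k by (intro box_per_cong) (auto simp: h_def)
  then show ?thesis
    using chain[of "{..<d} - {k}"] kd by (simp add: of_nat_diff)
qed

locale zero_free_angle =
  fixes d :: nat and \<theta> :: real
  assumes d: "2 \<le> d" and \<theta>_pos: "0 < \<theta>" and \<theta>_less: "(real d - 1) * \<theta> < 2 * pi / 3"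
begin

lemma \<theta>_half_less: "\<theta> / 2 < pi / 2"
proof -
  have "1 * \<theta> \<le> (real d - 1) * \<theta>"
    using d \<theta>_pos by (intro mult_right_mono) auto
  then show ?thesis
    using \<theta>_less pi_gt_zero by linarith
qed

lemma sin_half_less_1: "sin (\<theta> / 2) < 1" and sin_half_pos: "0 < sin (\<theta> / 2)"
  using \<theta>_half_less \<theta>_pos sin_monotone_2pi[of "\<theta> / 2" "pi / 2"] by (auto intro: sin_gt_zero)

text \<open>
  The statement proved by induction on the side length \<open>n\<close>. The angle bound is needed along with the
  absence of zeros: for the minors of size \<open>n\<close> it puts the terms of the expansion at size \<open>n + 1\<close> into a
  common sector.
\<close>

definition angle_invariant :: "('a list \<Rightarrow> complex) \<Rightarrow> nat \<Rightarrow> bool" where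
  "angle_invariant A n \<longleftrightarrow>
     (\<forall>S. (\<forall>j<d. finite (S j) \<and> card (S j) = n) \<longrightarrow> box_per d S A \<noteq> 0) \<and>
     (\<forall>T k R a b. k < d \<and> (\<forall>j<d. j \<noteq> k \<longrightarrow> finite (T j) \<and> card (T j) = n) \<and>
        finite R \<and> Suc (card R) = n \<and> a \<notin> R \<and> b \<notin> R \<longrightarrow>
        within_angle \<theta> (box_per d (T(k := insert a R)) A) (box_per d (T(k := insert b R)) A))"

lemma angle_invariant_nonzero:
  assumes "angle_invariant A n" "\<And>j. j < d \<Longrightarrow> finite (S j) \<and> card (S j) = n"
  shows "box_per d S A \<noteq> 0"
  using assms by (simp add: angle_invariant_def)

lemma angle_invariant_exchange:
  assumes "angle_invariant A n" "k < d" "\<And>j. j < d \<Longrightarrow> j \<noteq> k \<Longrightarrow> finite (T j) \<and> card (T j) = n"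
    and "finite R" "Suc (card R) = n" "a \<notin> R" "b \<notin> R"
  shows "within_angle \<theta> (box_per d (T(k := insert a R)) A) (box_per d (T(k := insert b R)) A)"
  using assms(1)[unfolded angle_invariant_def, THEN conjunct2, rule_format, of k T R a b] assms(2-)
  by blast

text \<open>
  \<open>U\<close> is what the permanent becomes when the entries of the slice are replaced by ones. By the invariant
  at size \<open>n\<close> the minors along the slice lie in a sector of opening \<open>(d - 1) \<theta>\<close>, and \<open>eta_bound\<close> is by
  definition the perturbation of the entries that such a sector tolerates.
\<close>

lemma slice_sums:
  fixes A :: "'a list \<Rightarrow> complex"
  assumes A: "\<And>x. norm (1 - A x) \<le> eta_bound d \<theta>" and inv: "angle_invariant A n"
    and S: "\<And>j. j < d \<Longrightarrow> finite (S j) \<and> card (S j) = Suc n" and k: "k < d" and a: "a \<in> S k"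
    and U: "U = (\<Sum>x\<in>slice d S k a. box_per d (strike S ((!) x)) A)"
  shows "U \<noteq> 0" and "\<exists>w. norm w \<le> sin (\<theta> / 2) \<and> box_per d S A = U * (1 + w)"
proof -
  let ?X = "slice d S k a" and ?\<alpha> = "(real d - 1) * \<theta>"
  have \<alpha>: "0 \<le> ?\<alpha>" "?\<alpha> < 2 * pi / 3"
    using d \<theta>_pos \<theta>_less by auto
  have entries: "norm (1 - A x) \<le> sin (\<theta> / 2) * cos (?\<alpha> / 2)" for x
    using A[of x] by (simp add: eta_bound_def)
  have fin: "finite ?X"
    by (rule finite_subset[of _ "index_box d S"]) (auto simp: finite_index_box S)
  have "S j \<noteq> {}" if "j < d" for j
    using S[OF that] by auto
  then have ne: "?X \<noteq> {}"
    using slice_nonempty[of k d S a] k a by blast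
  have ang: "within_angle ?\<alpha> (box_per d (strike S ((!) x)) A) (box_per d (strike S ((!) y)) A)"
    if "x \<in> ?X" "y \<in> ?X" for x y
  proof (rule within_angle_exchange_coords[OF less_imp_le[OF \<theta>_pos] k S])
    show "within_angle \<theta> (box_per d (T(m := insert a R)) A) (box_per d (T(m := insert b R)) A)"
      if "m < d" "\<And>j. j < d \<Longrightarrow> j \<noteq> m \<Longrightarrow> finite (T j) \<and> card (T j) = n" "finite R" "Suc (card R) = n"
        "a \<notin> R" "b \<notin> R" for T m R a b
      by (rule angle_invariant_exchange[OF inv that])
  qed (use that in \<open>auto simp: index_box_def\<close>)
  have nz': "box_per d (strike S ((!) x)) A \<noteq> 0" if "x \<in> ?X" for x
    using that S by (intro angle_invariant_nonzero[OF inv]) (auto simp: index_box_def)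
  have expand: "box_per d S A = (\<Sum>x\<in>?X. A x * box_per d (strike S ((!) x)) A)"
    using S by (intro box_per_expand[of d S k a, OF _ k a]) auto
  show "U \<noteq> 0"
    unfolding U by (rule weighted_sum_sector(1)[OF fin ne \<alpha> ang nz' entries])
  show "\<exists>w. norm w \<le> sin (\<theta> / 2) \<and> box_per d S A = U * (1 + w)"
    unfolding expand U by (rule weighted_sum_sector(2)[OF fin ne \<alpha> ang nz' entries])
qed

text \<open>
  The boxes \<open>T(k := insert a R)\<close> and \<open>T(k := insert b R)\<close> have the same minors along the slices \<open>a\<close> and \<open>b\<close>
  of coordinate \<open>k\<close>. So both permanents deviate by at most \<open>\<theta>/2\<close> from one and the same sum of minors.
\<close>

lemma angle_invariant:
  fixes A :: "'a list \<Rightarrow> complex"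
  assumes A: "\<And>x. norm (1 - A x) \<le> eta_bound d \<theta>"
  shows "angle_invariant A n"
proof (induction n)
  case 0
  have "box_per d S A \<noteq> 0" if S: "\<forall>j<d. finite (S j) \<and> card (S j) = 0" for S
  proof -
    have "S j = {}" if "j < d" for j
      using that S card_0_eq by blast
    then have "index_box d S = {}" "\<forall>j<d. S j = {}"
      using d by (auto simp: index_box_def intro!: exI[of _ 0])
    then have "matchings d S = {{}}"
      by (auto simp: matchings_def bij_betw_def)
    then show ?thesis by (simp add: box_per_def)
  qed
  then show ?case by (simp add: angle_invariant_def)
next
  case (Suc n)
  note sector = slice_sums[of A n, OF A Suc.IH _ _ _ refl]
  have "box_per d S A \<noteq> 0" if S: "\<forall>j<d. finite (S j) \<and> card (S j) = Suc n" for S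
  proof -
    have "S 0 \<noteq> {}"
      using S d by force
    then obtain c where c: "c \<in> S 0" by blast
    let ?U = "\<Sum>x\<in>slice d S 0 c. box_per d (strike S ((!) x)) A"
    have "?U \<noteq> 0"
      using S d by (intro sector(1) c) auto
    moreover obtain w where w: "norm w \<le> sin (\<theta> / 2)" "box_per d S A = ?U * (1 + w)"
      using sector(2)[of S 0 c] S d c by auto
    moreover have "1 + w \<noteq> 0"
      using w(1) sin_half_less_1 by (auto simp: add_eq_0_iff)
    ultimately show ?thesis by simp
  qed
  moreover have "within_angle \<theta> (box_per d (T(k := insert a R)) A) (box_per d (T(k := insert b R)) A)"
    if k: "k < d" and T: "\<forall>j<d. j \<noteq> k \<longrightarrow> finite (T j) \<and> card (T j) = Suc n"
      and R: "finite R" "card R = n" and ab: "a \<notin> R" "b \<notin> R" for T k R a b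
  proof -
    let ?V = "\<lambda>c. T(k := insert c R)"
    let ?X = "\<lambda>c. slice d (?V c) k c"
    let ?u = "\<lambda>c. \<Sum>x\<in>?X c. box_per d (strike (?V c) ((!) x)) A"
    have u_eq: "?u a = ?u b"
    proof (rule sum.reindex_bij_witness[of _ "\<lambda>x. x[k := a]" "\<lambda>x. x[k := b]"])
      fix x assume x: "x \<in> ?X a"
      then show "(x[k := b])[k := a] = x" by auto
      show "x[k := b] \<in> ?X b"
        using x k by (auto simp: index_box_def nth_list_update)
      show "box_per d (strike (?V b) ((!) (x[k := b]))) A = box_per d (strike (?V a) ((!) x)) A"
        using x k ab by (intro box_per_cong) (auto simp: index_box_def nth_list_update)
    next
      fix x assume x: "x \<in> ?X b"
      then show "(x[k := a])[k := b] = x" by auto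
      show "x[k := a] \<in> ?X a"
        using x k by (auto simp: index_box_def nth_list_update)
    qed
    have half: "within_angle (\<theta> / 2) (?u c) (box_per d (?V c) A)" if c: "c \<notin> R" for c
    proof -
      have "\<exists>w. norm w \<le> sin (\<theta> / 2) \<and> box_per d (?V c) A = ?u c * (1 + w)"
        by (rule sector(2)) (use T R k c in auto)
      then obtain w where "norm w \<le> sin (\<theta> / 2)" "box_per d (?V c) A = ?u c * (1 + w)"
        by blast
      then show ?thesis
        using within_angle_perturb[of w "\<theta> / 2"] \<theta>_pos \<theta>_half_less by auto
    qed
    have "within_angle (\<theta> / 2 + \<theta> / 2) (box_per d (?V a) A) (box_per d (?V b) A)"
      using within_angle_trans[OF within_angle_sym[OF half[OF ab(1)], unfolded u_eq] half[OF ab(2)]] .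
    then show ?thesis by simp
  qed
  ultimately show ?case
    unfolding angle_invariant_def by (intro conjI allI impI) auto
qed

lemma box_per_nonzero:
  fixes A :: "'a list \<Rightarrow> complex"
  assumes "\<And>x. norm (1 - A x) \<le> eta_bound d \<theta>" "\<And>j. j < d \<Longrightarrow> finite (S j) \<and> card (S j) = n"
  shows "box_per d S A \<noteq> 0"
  using angle_invariant_nonzero[OF angle_invariant] assms by blast

text \<open>
  The entries inside the slice do not occur in its minors, so the permanent of \<open>B\<close> is exactly the sum of
  the minors of \<open>A\<close> along the slice.
\<close>

lemma box_per_slice_ratio:
  fixes A B :: "'a list \<Rightarrow> complex"
  assumes A: "\<And>x. norm (1 - A x) \<le> eta_bound d \<theta>"
    and S: "\<And>j. j < d \<Longrightarrow> finite (S j) \<and> card (S j) = n" and k: "k < d" and a: "a \<in> S k"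
    and B: "\<And>x. x \<in> index_box d S \<Longrightarrow> B x = (if x ! k = a then 1 else A x)"
  shows "\<exists>w. norm w \<le> sin (\<theta> / 2) \<and> box_per d S A = box_per d S B * (1 + w)"
proof -
  let ?X = "slice d S k a"
  obtain n' where n': "n = Suc n'"
    using S[OF k] a by (cases n) auto
  have "B x * box_per d (strike S ((!) x)) B = box_per d (strike S ((!) x)) A" if x: "x \<in> ?X" for x
  proof -
    have "box_per d (strike S ((!) x)) B = box_per d (strike S ((!) x)) A"
    proof (rule box_per_cong_entries)
      fix y assume y: "y \<in> index_box d (strike S ((!) x))"
      then have "y ! k \<noteq> a"
        using k x by (auto simp: index_box_def)
      then show "B y = A y"
        using B[of y] y index_box_strike_subset by auto
    qed
    then show ?thesis
      using x B by simp
  qed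
  moreover have "box_per d S B = (\<Sum>x\<in>?X. B x * box_per d (strike S ((!) x)) B)"
    using S by (intro box_per_expand[of d S k a, OF _ k a]) auto
  ultimately have "box_per d S B = (\<Sum>x\<in>?X. box_per d (strike S ((!) x)) A)"
    by simp
  moreover have "\<exists>w. norm w \<le> sin (\<theta> / 2) \<and>
      box_per d S A = (\<Sum>x\<in>?X. box_per d (strike S ((!) x)) A) * (1 + w)"
    by (rule slice_sums(2)[of A n']) (use A angle_invariant[of A n'] S n' k a in auto)
  ultimately show ?thesis
    by simp
qed

end

section \<open>The permanent of a cubical tensor\<close>

lemma tensor_indices_eq_index_box: "tensor_indices d n = index_box d (\<lambda>_. {1..n})"
  unfolding tensor_indices_def index_box_def by (auto simp: subset_iff in_set_conv_nth)

text \<open>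
  The permutations \<open>\<sigma>\<^sub>2, \<dots>, \<sigma>\<^sub>d\<close> correspond to the matching \<open>{(i, \<sigma>\<^sub>2 i, \<dots>, \<sigma>\<^sub>d i) | i}\<close>. They are recovered
  from it by parametrizing the matching by its first coordinate.
\<close>

lemma PER_eq_box_per:
  fixes A :: "nat list \<Rightarrow> complex"
  assumes d: "1 \<le> d"
  shows "PER d n A = box_per d (\<lambda>_. {1..n}) A"
proof -
  define I where "I = {1..n}"
  define P where "P = {\<sigma>s. length \<sigma>s = d - 1 \<and> (\<forall>\<sigma>\<in>set \<sigma>s. \<sigma> permutes I)}"
  define row :: "(nat \<Rightarrow> nat) list \<Rightarrow> nat \<Rightarrow> nat list" where "row \<sigma>s i = i # map (\<lambda>\<sigma>. \<sigma> i) \<sigma>s" for \<sigma>s i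
  have inj_row: "inj_on (row \<sigma>s) I" for \<sigma>s
    by (auto simp: row_def inj_on_def)
  have row_Suc: "row \<sigma>s i ! Suc j = (\<sigma>s ! j) i" if "\<sigma>s \<in> P" "Suc j < d" for \<sigma>s i j
    using that by (auto simp: row_def P_def)
  have bij: "bij_betw (\<lambda>\<sigma>s. row \<sigma>s ` I) P (matchings d (\<lambda>_. I))"
  proof (rule bij_betw_imageI)
    show "inj_on (\<lambda>\<sigma>s. row \<sigma>s ` I) P"
    proof (rule inj_onI)
      fix \<sigma>s \<tau>s assume P: "\<sigma>s \<in> P" "\<tau>s \<in> P" and eq: "row \<sigma>s ` I = row \<tau>s ` I"
      have row_eq: "row \<sigma>s i = row \<tau>s i" if "i \<in> I" for i
      proof -
        have "row \<sigma>s i \<in> row \<tau>s ` I"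
          using that eq by blast
        then show ?thesis by (auto simp: row_def)
      qed
      show "\<sigma>s = \<tau>s"
      proof (rule nth_equalityI)
        show "length \<sigma>s = length \<tau>s"
          using P by (simp add: P_def)
        fix j assume j: "j < length \<sigma>s"
        then have j': "Suc j < d" "j < length \<tau>s"
          using P by (auto simp: P_def)
        have "(\<sigma>s ! j) i = (\<tau>s ! j) i" for i
        proof (cases "i \<in> I")
          case True
          then show ?thesis
            using row_eq[OF True] row_Suc[OF P(1) j'(1), of i] row_Suc[OF P(2) j'(1), of i] by simp
        next
          case False
          moreover have "(\<sigma>s ! j) permutes I" "(\<tau>s ! j) permutes I"
            using P j j' by (auto simp: P_def)
          ultimately show ?thesis
            by (simp add: permutes_not_in)
        qed
        then show "\<sigma>s ! j = \<tau>s ! j" by blast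
      qed
    qed
    show "(\<lambda>\<sigma>s. row \<sigma>s ` I) ` P = matchings d (\<lambda>_. I)"
    proof
      show "(\<lambda>\<sigma>s. row \<sigma>s ` I) ` P \<subseteq> matchings d (\<lambda>_. I)"
      proof (clarify)
        fix \<sigma>s assume \<sigma>s: "\<sigma>s \<in> P"
        have bij_row: "bij_betw (\<lambda>i. row \<sigma>s i ! j) I I" if "j < d" for j
        proof (cases j)
          case 0
          then show ?thesis
            by (simp add: row_def bij_betw_def inj_on_def)
        next
          case (Suc j')
          then have "(\<sigma>s ! j') permutes I"
            using that \<sigma>s by (auto simp: P_def)
          then have "bij_betw (\<sigma>s ! j') I I"
            by (rule permutes_imp_bij)
          then show ?thesis
            unfolding Suc using row_Suc[OF \<sigma>s, of j'] that Suc by simp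
        qed
        moreover have "bij_betw (\<lambda>x. x ! j) (row \<sigma>s ` I) I" if "j < d" for j
          using bij_betw_comp_iff[OF inj_on_imp_bij_betw[OF inj_row, of \<sigma>s], of "\<lambda>x. x ! j" I]
            bij_row[OF that] by (simp add: comp_def)
        moreover have "length (row \<sigma>s i) = d" for i
          using \<sigma>s d by (simp add: row_def P_def)
        ultimately show "row \<sigma>s ` I \<in> matchings d (\<lambda>_. I)"
          by (auto simp: matchings_def index_box_def dest: bij_betwE)
      qed
      show "matchings d (\<lambda>_. I) \<subseteq> (\<lambda>\<sigma>s. row \<sigma>s ` I) ` P"
      proof
        fix M assume M: "M \<in> matchings d (\<lambda>_. I)"
        have bijM: "bij_betw (\<lambda>x. x ! j) M I" if "j < d" for j
          using M that by (simp add: matchings_def)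
        define g where "g = the_inv_into M (\<lambda>x. x ! 0)"
        have g: "bij_betw g I M"
          unfolding g_def using bijM[of 0] d by (intro bij_betw_the_inv_into) auto
        have g0: "g i ! 0 = i" if "i \<in> I" for i
          unfolding g_def using bijM[of 0] d that by (intro f_the_inv_into_f_bij_betw) auto
        define \<sigma>s where "\<sigma>s = map (\<lambda>j i. if i \<in> I then g i ! Suc j else i) [0..<d - 1]"
        have perm: "(\<lambda>i. if i \<in> I then g i ! Suc j else i) permutes I" if "Suc j < d" for j
        proof (rule bij_imp_permutes)
          have "bij_betw ((\<lambda>x. x ! Suc j) \<circ> g) I I"
            using g bijM[OF that] by (rule bij_betw_trans)
          then show "bij_betw (\<lambda>i. if i \<in> I then g i ! Suc j else i) I I"
            by (rule bij_betw_cong[THEN iffD1, rotated]) simp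
        qed simp
        then have "\<sigma>s \<in> P"
          by (auto simp: \<sigma>s_def P_def)
        moreover have "row \<sigma>s i = g i" if "i \<in> I" for i
        proof (rule nth_equalityI)
          have "g i \<in> index_box d (\<lambda>_. I)"
            using M bij_betwE[OF g] that by (auto simp: matchings_def)
          then show "length (row \<sigma>s i) = length (g i)"
            using d by (simp add: row_def \<sigma>s_def index_box_def)
          fix j assume "j < length (row \<sigma>s i)"
          then show "row \<sigma>s i ! j = g i ! j"
            using that g0 by (cases j) (auto simp: row_def \<sigma>s_def)
        qed
        then have "M = row \<sigma>s ` I"
          using g by (simp add: bij_betw_def)
        ultimately show "M \<in> (\<lambda>\<sigma>s. row \<sigma>s ` I) ` P" by blast
      qed
    qed
  qed
  have "PER d n A = (\<Sum>\<sigma>s\<in>P. \<Prod>i\<in>I. A (row \<sigma>s i))"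
    by (simp add: PER_def P_def I_def row_def)
  also have "\<dots> = (\<Sum>\<sigma>s\<in>P. \<Prod>x\<in>row \<sigma>s ` I. A x)"
    by (simp add: prod.reindex[OF inj_row])
  also have "\<dots> = box_per d (\<lambda>_. I) A"
    unfolding box_per_def by (rule sum.reindex_bij_betw[OF bij])
  finally show ?thesis by (simp add: I_def)
qed

lemma PER_cong:
  assumes "1 \<le> d" "\<And>x. x \<in> tensor_indices d n \<Longrightarrow> A x = B x"
  shows "PER d n A = PER d n B"
  using assms box_per_cong_entries[of d "\<lambda>_. {1..n}" A B]
  unfolding PER_eq_box_per[OF assms(1)] tensor_indices_eq_index_box by blast

section \<open>An explicit branch of the logarithm\<close>

text \<open>
  The slices \<open>1, \<dots>, i\<close> of \<open>Z\<close> followed by slices of ones: a path from the all-ones tensor (\<open>i = 0\<close>) to \<open>Z\<close>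
  (\<open>i = n\<close>), up to entries outside the index set.
\<close>

definition fill_ones :: "nat \<Rightarrow> (nat list \<Rightarrow> complex) \<Rightarrow> nat list \<Rightarrow> complex" where
  "fill_ones i Z = (\<lambda>x. if hd x \<le> i then Z x else 1)"

definition slice_ratio :: "nat \<Rightarrow> nat \<Rightarrow> nat \<Rightarrow> (nat list \<Rightarrow> complex) \<Rightarrow> complex" where
  "slice_ratio d n i Z = PER d n (fill_ones i Z) / PER d n (fill_ones (i - 1) Z)"

definition ln_PER_sum :: "nat \<Rightarrow> nat \<Rightarrow> (nat list \<Rightarrow> complex) \<Rightarrow> complex" where
  "ln_PER_sum d n Z = Ln (PER d n (\<lambda>_. 1)) + (\<Sum>i=1..n. Ln (slice_ratio d n i Z))"

text \<open>
  The condition that defines \<open>tensor_polydisc\<close>, without extensionality, so that it is stable under the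
  entrywise constructions used below.
\<close>

definition near_ones :: "nat \<Rightarrow> nat \<Rightarrow> real \<Rightarrow> (nat list \<Rightarrow> complex) \<Rightarrow> bool" where
  "near_ones d n r Z \<longleftrightarrow> (\<forall>x\<in>tensor_indices d n. norm (1 - Z x) \<le> r)"

lemma near_ones_fill_ones: "near_ones d n r Z \<Longrightarrow> 0 \<le> r \<Longrightarrow> near_ones d n r (fill_ones i Z)"
  by (auto simp: near_ones_def fill_ones_def)

lemma hd_tensor_index:
  assumes "1 \<le> d" "x \<in> tensor_indices d n"
  shows "hd x = x ! 0" "1 \<le> hd x" "hd x \<le> n"
proof -
  have "x \<noteq> []"
    using assms by (auto simp: tensor_indices_def)
  then show "hd x = x ! 0"
    by (rule hd_conv_nth)
  have "hd x \<in> {1..n}"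
    using assms \<open>x \<noteq> []\<close> by (auto simp: tensor_indices_def subset_iff)
  then show "1 \<le> hd x" "hd x \<le> n" by auto
qed

lemma fill_ones_last: "1 \<le> d \<Longrightarrow> PER d n (fill_ones n Z) = PER d n Z"
  using hd_tensor_index(3)[of d] by (intro PER_cong) (auto simp: fill_ones_def)

lemma fill_ones_0: "1 \<le> d \<Longrightarrow> PER d n (fill_ones 0 Z) = PER d n (\<lambda>_. 1)"
  using hd_tensor_index(2)[of d] by (intro PER_cong) (force simp: fill_ones_def)+

context zero_free_angle
begin

lemma eta_bound_pos: "0 < eta_bound d \<theta>"
proof -
  have "0 \<le> (real d - 1) * \<theta>"
    using d \<theta>_pos by simp
  then have "cos ((real d - 1) * \<theta> / 2) > 0"
    using \<theta>_less by (intro cos_gt_zero_pi) auto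
  then show ?thesis
    using sin_half_pos by (simp add: eta_bound_def)
qed

text \<open>
  Entries outside the index set are arbitrary in \<open>near_ones\<close>; setting them to one makes the bound hold
  everywhere and leaves the permanent unchanged.
\<close>

lemma PER_nonzero:
  assumes "near_ones d n (eta_bound d \<theta>) Z"
  shows "PER d n Z \<noteq> 0"
proof -
  define A where "A x = (if x \<in> tensor_indices d n then Z x else 1)" for x
  have "norm (1 - A x) \<le> eta_bound d \<theta>" for x
    using assms eta_bound_pos by (simp add: A_def near_ones_def)
  then have "box_per d (\<lambda>_. {1..n}) A \<noteq> 0"
    by (rule box_per_nonzero[of A _ n]) auto
  moreover have "PER d n Z = PER d n A"
    using d by (intro PER_cong) (auto simp: A_def)
  ultimately show ?thesis
    using d by (simp add: PER_eq_box_per)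
qed

lemma slice_ratio_near_1:
  assumes Z: "near_ones d n (eta_bound d \<theta>) Z" and i: "1 \<le> i" "i \<le> n"
  shows "norm (slice_ratio d n i Z - 1) \<le> sin (\<theta> / 2)"
proof -
  define A where "A x = (if x \<in> tensor_indices d n then fill_ones i Z x else 1)" for x
  have A: "norm (1 - A x) \<le> eta_bound d \<theta>" for x
    using near_ones_fill_ones[OF Z, of i] eta_bound_pos by (simp add: A_def near_ones_def)
  have "\<exists>w. norm w \<le> sin (\<theta> / 2) \<and> box_per d (\<lambda>_. {1..n}) A =
      box_per d (\<lambda>_. {1..n}) (fill_ones (i - 1) Z) * (1 + w)"
  proof (rule box_per_slice_ratio[OF A, where k = 0 and a = i and n = n])
    fix x assume "x \<in> index_box d (\<lambda>_. {1..n})"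
    then have "x \<in> tensor_indices d n"
      by (simp add: tensor_indices_eq_index_box)
    then show "fill_ones (i - 1) Z x = (if x ! 0 = i then 1 else A x)"
      using i d hd_tensor_index(1)[of d x n] by (auto simp: A_def fill_ones_def)
  qed (use d i in auto)
  then obtain w where w: "norm w \<le> sin (\<theta> / 2)"
      "PER d n A = PER d n (fill_ones (i - 1) Z) * (1 + w)"
    using d by (auto simp: PER_eq_box_per)
  moreover have "PER d n A = PER d n (fill_ones i Z)"
    using d by (intro PER_cong) (auto simp: A_def)
  moreover have "PER d n (fill_ones (i - 1) Z) \<noteq> 0"
    using Z eta_bound_pos by (intro PER_nonzero near_ones_fill_ones) auto
  ultimately show ?thesis
    by (simp add: slice_ratio_def)
qed

lemma slice_ratio_not_nonpos:
  assumes "near_ones d n (eta_bound d \<theta>) Z" "1 \<le> i" "i \<le> n"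
  shows "slice_ratio d n i Z \<notin> \<real>\<^sub>\<le>\<^sub>0"
proof -
  have "norm (slice_ratio d n i Z - 1) < 1"
    using slice_ratio_near_1[OF assms] sin_half_less_1 by linarith
  then have "Re (slice_ratio d n i Z) > 0"
    using abs_Re_le_cmod[of "slice_ratio d n i Z - 1"] by auto
  then show ?thesis
    by (auto simp: complex_nonpos_Reals_iff)
qed

lemma PER_ones_pos: "\<exists>c>0. PER d n (\<lambda>_. 1) = of_real c"
proof -
  have "PER d n (\<lambda>_. 1) \<noteq> 0"
    using eta_bound_pos by (intro PER_nonzero) (simp add: near_ones_def)
  then show ?thesis
    by (intro exI[of _ "real (card {\<sigma>s. length \<sigma>s = d - 1 \<and> (\<forall>\<sigma>\<in>set \<sigma>s. \<sigma> permutes {1..n})})"])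
      (auto simp: PER_def intro!: Nat.gr0I)
qed

text \<open>
  The product of the slice ratios telescopes to \<open>PER Z / PER J\<close>.
\<close>

lemma exp_ln_PER_sum:
  assumes Z: "near_ones d n (eta_bound d \<theta>) Z"
  shows "exp (ln_PER_sum d n Z) = PER d n Z"
proof -
  have nz: "PER d n (fill_ones i Z) \<noteq> 0" for i
    using Z eta_bound_pos by (intro PER_nonzero near_ones_fill_ones) auto
  have "PER d n (\<lambda>_. 1) * (\<Prod>i=1..m. slice_ratio d n i Z) = PER d n (fill_ones m Z)" for m
  proof (induction m)
    case 0
    then show ?case
      using d by (simp add: fill_ones_0)
  next
    case (Suc m)
    have "PER d n (\<lambda>_. 1) * (\<Prod>i=1..Suc m. slice_ratio d n i Z)
        = PER d n (fill_ones m Z) * slice_ratio d n (Suc m) Z"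
      using Suc by (simp add: mult.assoc[symmetric])
    then show ?case
      using nz by (simp add: slice_ratio_def)
  qed
  moreover have "exp (\<Sum>i=1..n. Ln (slice_ratio d n i Z)) = (\<Prod>i=1..n. slice_ratio d n i Z)"
    unfolding exp_sum[OF finite_atLeastAtMost]
    using nz by (intro prod.cong) (auto simp: slice_ratio_def)
  moreover have "PER d n (\<lambda>_. 1) \<noteq> 0"
    using PER_ones_pos[of n] by auto
  ultimately show ?thesis
    using d by (simp add: ln_PER_sum_def exp_add fill_ones_last)
qed

lemma continuous_on_PER_fill_ones: "continuous_on S (\<lambda>Z. PER d n (fill_ones i Z))"
proof -
  have "continuous_on S (\<lambda>Z. fill_ones i Z x)" for x
    unfolding fill_ones_def
    by (cases "hd x \<le> i") (auto intro: continuous_on_subset[OF continuous_on_product_coordinates])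
  then show ?thesis
    unfolding PER_def by (intro continuous_intros)
qed

text \<open>
  The slice ratios stay in the right half-plane, where the principal logarithm is continuous. At a real
  tensor they are real, hence positive, and have real logarithms.
\<close>

lemma is_ln_PER_ln_PER_sum: "is_ln_PER d n (eta_bound d \<theta>) (ln_PER_sum d n)"
proof -
  let ?D = "tensor_polydisc d n (eta_bound d \<theta>)"
  have D: "near_ones d n (eta_bound d \<theta>) Z" if "Z \<in> ?D" for Z
    using that by (simp add: tensor_polydisc_def near_ones_def)
  have nz: "PER d n (fill_ones i Z) \<noteq> 0" if "Z \<in> ?D" for i Z
    using D[OF that] eta_bound_pos by (intro PER_nonzero near_ones_fill_ones) auto
  have "continuous_on ?D (ln_PER_sum d n)"
    unfolding ln_PER_sum_def
  proof (intro continuous_intros continuous_on_Ln)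
    fix i assume "i \<in> {1..n}"
    then show "continuous_on ?D (slice_ratio d n i)"
      unfolding slice_ratio_def
      using nz by (intro continuous_intros continuous_on_PER_fill_ones) auto
    show "slice_ratio d n i Z \<notin> \<real>\<^sub>\<le>\<^sub>0" if "Z \<in> ?D" for Z
      using D[OF that] \<open>i \<in> {1..n}\<close> by (intro slice_ratio_not_nonpos) auto
  qed
  moreover have "ln_PER_sum d n Z \<in> \<real>"
    if Z: "Z \<in> ?D" and real: "\<forall>x\<in>tensor_indices d n. Z x \<in> \<real>" for Z
  proof -
    have "PER d n (fill_ones i Z) \<in> \<real>" for i
    proof -
      have "PER d n (fill_ones i Z) = PER d n (\<lambda>x. if x \<in> tensor_indices d n then fill_ones i Z x else 1)"
        using d by (intro PER_cong) auto
      also have "\<dots> \<in> \<real>"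
        unfolding PER_def using real by (intro sum_in_Reals prod_in_Reals) (auto simp: fill_ones_def)
      finally show ?thesis .
    qed
    then have ratio: "slice_ratio d n i Z \<in> \<real>" for i
      by (simp add: slice_ratio_def)
    have "Ln (slice_ratio d n i Z) \<in> \<real>" if "i \<in> {1..n}" for i
    proof -
      have "Ln z \<in> \<real>" if z: "z \<in> \<real>" "z \<notin> \<real>\<^sub>\<le>\<^sub>0" for z
      proof -
        obtain x where "z = of_real x"
          using z(1) by (auto elim: Reals_cases)
        moreover from this have "x > 0"
          using z(2) by simp
        ultimately show ?thesis by (simp add: Ln_of_real)
      qed
      then show ?thesis
        using ratio slice_ratio_not_nonpos[OF D[OF Z]] that by auto
    qed
    moreover obtain c where "c > 0" "PER d n (\<lambda>_. 1) = of_real c"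
      using PER_ones_pos by blast
    ultimately show ?thesis
      unfolding ln_PER_sum_def by (intro Reals_add sum_in_Reals) (auto simp: Ln_of_real)
  qed
  ultimately show ?thesis
    using exp_ln_PER_sum D by (auto simp: is_ln_PER_def)
qed

end

lemma tensor_polydisc_segment:
  assumes "Z \<in> tensor_polydisc d n r" "0 \<le> t" "t \<le> 1"
  shows "restrict (\<lambda>x. 1 + of_real t * (Z x - 1)) (tensor_indices d n) \<in> tensor_polydisc d n r"
proof -
  have "norm (1 - (1 + of_real t * (Z x - 1))) \<le> r" if x: "x \<in> tensor_indices d n" for x
  proof -
    have "norm (1 - (1 + of_real t * (Z x - 1))) = t * norm (1 - Z x)"
      using assms(2) by (simp add: norm_mult norm_minus_commute)
    also have "\<dots> \<le> 1 * norm (1 - Z x)"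
      using assms by (intro mult_right_mono) auto
    also have "\<dots> \<le> r"
      using assms(1) x by (simp add: tensor_polydisc_def)
    finally show ?thesis .
  qed
  then show ?thesis
    by (auto simp: tensor_polydisc_def tensors_def)
qed

text \<open>
  Along the segment from the all-ones tensor to \<open>Z\<close> the difference of two branches is continuous with
  values in \<open>2\<pi>\<i>\<int>\<close>, hence constant; it vanishes at the all-ones tensor, where both branches are real.
\<close>

lemma is_ln_PER_unique:
  assumes K: "is_ln_PER d n r K" and L: "is_ln_PER d n r L" and Z: "Z \<in> tensor_polydisc d n r"
  shows "K Z = L Z"
proof -
  define path where "path t = restrict (\<lambda>x. 1 + of_real t * (Z x - 1)) (tensor_indices d n)" for t :: real
  have path_in: "path t \<in> tensor_polydisc d n r" if "t \<in> {0..1}" for t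
    unfolding path_def using that by (intro tensor_polydisc_segment[OF Z]) auto
  have "continuous_on {0..1} path"
    unfolding path_def restrict_def
  proof (rule continuous_on_coordinatewise_then_product)
    fix x
    show "continuous_on {0..1} (\<lambda>t. if x \<in> tensor_indices d n then 1 + of_real t * (Z x - 1) else undefined)"
      by (cases "x \<in> tensor_indices d n") (auto intro!: continuous_intros)
  qed
  then have cont: "continuous_on {0..1} (\<lambda>t. K (path t) - L (path t))"
    using K L path_in unfolding is_ln_PER_def
    by (intro continuous_on_diff continuous_on_compose2[of "tensor_polydisc d n r" K _ path]
        continuous_on_compose2[of "tensor_polydisc d n r" L _ path]) auto
  have exp_eq: "exp (K (path t)) = exp (L (path t))" if "t \<in> {0..1}" for t
    using K L path_in[OF that] by (simp add: is_ln_PER_def)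
  have "(\<lambda>t. K (path t) - L (path t)) constant_on {0..1}"
  proof (rule continuous_discrete_range_constant[OF _ cont])
    fix s :: real assume s: "s \<in> {0..1}"
    have "2 * pi \<le> norm ((K (path t) - L (path t)) - (K (path s) - L (path s)))"
      if t: "t \<in> {0..1}" and ne: "K (path t) - L (path t) \<noteq> K (path s) - L (path s)" for t
    proof -
      obtain a b :: int where ab: "K (path t) = L (path t) + (of_int (2 * a) * pi) * \<i>"
          "K (path s) = L (path s) + (of_int (2 * b) * pi) * \<i>"
        using exp_eq[OF t] exp_eq[OF s] unfolding Complex_Transcendental.exp_eq by blast
      then have "norm ((K (path t) - L (path t)) - (K (path s) - L (path s)))
          = norm (complex_of_real (of_int (a - b) * (2 * pi)) * \<i>)"
        by (intro arg_cong[of _ _ norm]) (simp add: algebra_simps)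
      also have "\<dots> = \<bar>of_int (a - b)\<bar> * (2 * pi)"
        by (simp add: norm_mult abs_mult del: of_real_mult)
      finally have "norm ((K (path t) - L (path t)) - (K (path s) - L (path s))) = \<bar>of_int (a - b)\<bar> * (2 * pi)" .
      moreover have "a \<noteq> b"
        using ne ab by auto
      then have "1 \<le> \<bar>a - b\<bar>" by simp
      then have "1 \<le> \<bar>of_int (a - b) :: real\<bar>"
        by linarith
      ultimately show ?thesis
        by (simp add: mult_le_cancel_right1)
    qed
    then show "\<exists>e>0. \<forall>t. t \<in> {0..1} \<and> K (path t) - L (path t) \<noteq> K (path s) - L (path s) \<longrightarrow>
        e \<le> norm ((K (path t) - L (path t)) - (K (path s) - L (path s)))"
      by (intro exI[of _ "2 * pi"]) auto
  qed auto
  then have const: "K (path 1) - L (path 1) = K (path 0) - L (path 0)"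
    unfolding constant_on_def by force
  have "path 1 = Z"
    using Z by (auto simp: path_def tensor_polydisc_def tensors_def fun_eq_iff PiE_def extensional_def restrict_def)
  have "K (path 0) \<in> \<real>" "L (path 0) \<in> \<real>"
    using K L path_in[of 0] unfolding is_ln_PER_def by (auto simp: path_def)
  then obtain a b where "K (path 0) = of_real a" "L (path 0) = of_real b"
    unfolding Reals_def by blast
  then have "K (path 0) = L (path 0)"
    using exp_eq[of 0] by (simp add: exp_of_real)
  then show ?thesis
    using const \<open>path 1 = Z\<close> by simp
qed

lemma ln_PER_eqI:
  assumes L: "is_ln_PER d n r L" and Z: "Z \<in> tensor_polydisc d n r"
  shows "ln_PER d n r Z = L Z"
proof -
  let ?D = "tensor_polydisc d n r"
  have ext: "is_ln_PER d n r (restrict L ?D)"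
    using L by (auto simp: is_ln_PER_def cong: continuous_on_cong)
  have "ln_PER d n r = restrict L ?D"
    unfolding ln_PER_def
  proof (rule the_equality)
    fix K assume K: "K \<in> extensional ?D \<and> is_ln_PER d n r K"
    show "K = restrict L ?D"
      using K is_ln_PER_unique[OF _ ext] by (intro extensionalityI[of _ ?D]) auto
  qed (use ext in auto)
  then show ?thesis
    using Z by simp
qed

section \<open>Polynomial functions of bounded degree\<close>

definition monom_eval :: "('v \<Rightarrow>\<^sub>0 nat) \<Rightarrow> ('v \<Rightarrow> 'a::comm_semiring_1) \<Rightarrow> 'a" where
  "monom_eval m x = (\<Prod>v\<in>Poly_Mapping.keys m. x v ^ Poly_Mapping.lookup m v)"

definition monom_degree :: "('v \<Rightarrow>\<^sub>0 nat) \<Rightarrow> nat" where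
  "monom_degree m = (\<Sum>v\<in>Poly_Mapping.keys m. Poly_Mapping.lookup m v)"

lemma monom_eval_superset:
  "finite V \<Longrightarrow> Poly_Mapping.keys m \<subseteq> V \<Longrightarrow> monom_eval m x = (\<Prod>v\<in>V. x v ^ Poly_Mapping.lookup m v)"
  unfolding monom_eval_def by (rule prod.mono_neutral_left) (auto simp: in_keys_iff)

lemma monom_degree_superset:
  "finite V \<Longrightarrow> Poly_Mapping.keys m \<subseteq> V \<Longrightarrow> monom_degree m = (\<Sum>v\<in>V. Poly_Mapping.lookup m v)"
  unfolding monom_degree_def by (rule sum.mono_neutral_left) (auto simp: in_keys_iff)

lemma monom_eval_add: "monom_eval (a + b) x = monom_eval a x * monom_eval b x"
  using Poly_Mapping.keys_add[of a b]
  by (simp add: monom_eval_superset[of "Poly_Mapping.keys a \<union> Poly_Mapping.keys b"]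
      lookup_add power_add prod.distrib)

lemma monom_degree_add: "monom_degree (a + b) = monom_degree a + monom_degree b"
  using Poly_Mapping.keys_add[of a b]
  by (simp add: monom_degree_superset[of "Poly_Mapping.keys a \<union> Poly_Mapping.keys b"]
      lookup_add sum.distrib)

lemma mpoly_eval_superset:
  "finite K \<Longrightarrow> Poly_Mapping.keys p \<subseteq> K \<Longrightarrow>
    mpoly_eval p x = (\<Sum>m\<in>K. Poly_Mapping.lookup p m * monom_eval m x)"
  unfolding mpoly_eval_def monom_eval_def by (rule sum.mono_neutral_left) (auto simp: in_keys_iff)

lemma mpoly_eval_add: "mpoly_eval (p + q) x = mpoly_eval p x + mpoly_eval q x"
  using Poly_Mapping.keys_add[of p q]
  by (simp add: mpoly_eval_superset[of "Poly_Mapping.keys p \<union> Poly_Mapping.keys q"]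
      lookup_add sum.distrib algebra_simps)

lemma mpoly_eval_single: "mpoly_eval (Poly_Mapping.single m c) x = c * monom_eval m x"
  by (simp add: mpoly_eval_superset[of "{m}"])

lemma mpoly_eval_sum: "mpoly_eval (\<Sum>i\<in>I. p i) x = (\<Sum>i\<in>I. mpoly_eval (p i) x)"
  by (induction I rule: infinite_finite_induct) (simp_all add: mpoly_eval_add, simp_all add: mpoly_eval_def)

text \<open>
  This decomposition reduces multiplicativity of evaluation to the case of monomials.
\<close>

lemma mpoly_eq_sum_singles:
  "p = (\<Sum>m\<in>Poly_Mapping.keys p. Poly_Mapping.single m (Poly_Mapping.lookup p m))"
  by (rule poly_mapping_eqI) (simp add: lookup_sum lookup_single when_def in_keys_iff)

lemma mpoly_eval_mult:
  fixes p q :: "('v, 'a::comm_semiring_1) mpoly"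
  shows "mpoly_eval (p * q) x = mpoly_eval p x * mpoly_eval q x"
proof -
  let ?K = "Poly_Mapping.keys" and ?l = "Poly_Mapping.lookup"
  have "p * q = (\<Sum>a\<in>?K p. Poly_Mapping.single a (?l p a)) * (\<Sum>b\<in>?K q. Poly_Mapping.single b (?l q b))"
    by (simp flip: mpoly_eq_sum_singles)
  also have "\<dots> = (\<Sum>a\<in>?K p. \<Sum>b\<in>?K q. Poly_Mapping.single (a + b) (?l p a * ?l q b))"
    by (simp add: sum_product mult_single)
  finally have "mpoly_eval (p * q) x
      = (\<Sum>a\<in>?K p. \<Sum>b\<in>?K q. (?l p a * monom_eval a x) * (?l q b * monom_eval b x))"
    by (simp add: mpoly_eval_sum mpoly_eval_single monom_eval_add mult_ac)
  then show ?thesis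
    by (simp add: mpoly_eval_superset[OF finite_keys order_refl] flip: sum_product)
qed

text \<open>
  The degree bound is stated for each monomial, which makes closure under sums and products immediate.
\<close>

definition poly_fun :: "'v set \<Rightarrow> nat \<Rightarrow> (('v \<Rightarrow> complex) \<Rightarrow> complex) \<Rightarrow> bool" where
  "poly_fun V k F \<longleftrightarrow> (\<exists>p. (\<forall>m\<in>Poly_Mapping.keys p. Poly_Mapping.keys m \<subseteq> V \<and> monom_degree m \<le> k) \<and>
     (\<forall>x. mpoly_eval p x = F x))"

lemma poly_funE:
  assumes "poly_fun V k F"
  obtains p where "mpoly_vars p \<subseteq> V" "mpoly_degree p \<le> k" "\<And>x. mpoly_eval p x = F x"
proof -
  obtain p where p: "\<forall>m\<in>Poly_Mapping.keys p. Poly_Mapping.keys m \<subseteq> V \<and> monom_degree m \<le> k"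
      "\<forall>x. mpoly_eval p x = F x"
    using assms unfolding poly_fun_def by blast
  show thesis
  proof (rule that)
    show "mpoly_vars p \<subseteq> V"
      using p(1) by (auto simp: mpoly_vars_def)
    show "mpoly_degree p \<le> k"
      unfolding mpoly_degree_def using p(1) by (auto simp: monom_degree_def)
  qed (use p(2) in simp)
qed

lemma poly_fun_mono: "poly_fun V k F \<Longrightarrow> k \<le> l \<Longrightarrow> poly_fun V l F"
  unfolding poly_fun_def by (meson order_trans)

lemma poly_fun_const: "poly_fun V k (\<lambda>_. c)"
  unfolding poly_fun_def
  by (rule exI[of _ "Poly_Mapping.single 0 c"])
    (auto simp: mpoly_eval_single monom_eval_def monom_degree_def)

lemma poly_fun_var:
  assumes "v \<in> V"
  shows "poly_fun V (Suc k) (\<lambda>x. x v)"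
  unfolding poly_fun_def using assms
  by (intro exI[of _ "Poly_Mapping.single (Poly_Mapping.single v 1) 1"])
    (auto simp: mpoly_eval_single monom_eval_def monom_degree_def)

lemma poly_fun_add:
  assumes "poly_fun V k F" "poly_fun V k G"
  shows "poly_fun V k (\<lambda>x. F x + G x)"
proof -
  obtain p q where p: "\<forall>m\<in>Poly_Mapping.keys p. Poly_Mapping.keys m \<subseteq> V \<and> monom_degree m \<le> k"
      "\<forall>x. mpoly_eval p x = F x"
    and q: "\<forall>m\<in>Poly_Mapping.keys q. Poly_Mapping.keys m \<subseteq> V \<and> monom_degree m \<le> k"
      "\<forall>x. mpoly_eval q x = G x"
    using assms unfolding poly_fun_def by blast
  have "\<forall>m\<in>Poly_Mapping.keys (p + q). Poly_Mapping.keys m \<subseteq> V \<and> monom_degree m \<le> k"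
    using p(1) q(1) Poly_Mapping.keys_add[of p q] by blast
  then show ?thesis
    unfolding poly_fun_def using p(2) q(2) by (intro exI[of _ "p + q"]) (auto simp: mpoly_eval_add)
qed

lemma poly_fun_mult:
  assumes "poly_fun V k F" "poly_fun V l G"
  shows "poly_fun V (k + l) (\<lambda>x. F x * G x)"
proof -
  obtain p q where p: "\<forall>m\<in>Poly_Mapping.keys p. Poly_Mapping.keys m \<subseteq> V \<and> monom_degree m \<le> k"
      "\<forall>x. mpoly_eval p x = F x"
    and q: "\<forall>m\<in>Poly_Mapping.keys q. Poly_Mapping.keys m \<subseteq> V \<and> monom_degree m \<le> l"
      "\<forall>x. mpoly_eval q x = G x"
    using assms unfolding poly_fun_def by blast
  have "Poly_Mapping.keys m \<subseteq> V \<and> monom_degree m \<le> k + l" if m_in: "m \<in> Poly_Mapping.keys (p * q)" for m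
  proof -
    obtain a b where m: "m = a + b" and ab: "a \<in> Poly_Mapping.keys p" "b \<in> Poly_Mapping.keys q"
      using m_in keys_mult[of p q] by blast
    have "Poly_Mapping.keys m \<subseteq> V"
      using p(1) q(1) ab Poly_Mapping.keys_add[of a b] unfolding m by blast
    moreover have "monom_degree m \<le> k + l"
      using p(1) q(1) ab unfolding m monom_degree_add by (simp add: add_mono)
    ultimately show ?thesis ..
  qed
  then show ?thesis
    unfolding poly_fun_def using p(2) q(2) by (intro exI[of _ "p * q"]) (auto simp: mpoly_eval_mult)
qed

lemma poly_fun_cmult: "poly_fun V k F \<Longrightarrow> poly_fun V k (\<lambda>x. c * F x)"
  using poly_fun_mult[OF poly_fun_const[of V 0 c]] by simp

lemma poly_fun_diff: "poly_fun V k F \<Longrightarrow> poly_fun V k G \<Longrightarrow> poly_fun V k (\<lambda>x. F x - G x)"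
  using poly_fun_add[of V k F "\<lambda>x. (-1) * G x"] poly_fun_cmult[of V k G "-1"] by simp

lemma poly_fun_sum:
  "(\<And>i. i \<in> I \<Longrightarrow> poly_fun V k (F i)) \<Longrightarrow> poly_fun V k (\<lambda>x. \<Sum>i\<in>I. F i x)"
  by (induction I rule: infinite_finite_induct) (auto intro: poly_fun_const poly_fun_add)

text \<open>
  Polynomials in a scaling variable \<open>t\<close> whose coefficient of \<open>t\<^sup>k\<close> has degree at most \<open>k\<close> in the variables
  \<open>x\<close>. This class is closed under sums and products and contains the linear factors \<open>1 + t (x\<^sub>v - 1)\<close>, hence
  contains the permanent along the ray from the all-ones tensor.
\<close>

definition graded :: "'v set \<Rightarrow> (('v \<Rightarrow> complex) \<Rightarrow> complex poly) \<Rightarrow> bool" where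
  "graded V P \<longleftrightarrow> (\<forall>k. poly_fun V k (\<lambda>x. coeff (P x) k))"

lemma graded_sum: "(\<And>i. i \<in> I \<Longrightarrow> graded V (P i)) \<Longrightarrow> graded V (\<lambda>x. \<Sum>i\<in>I. P i x)"
  unfolding graded_def coeff_sum by (auto intro: poly_fun_sum)

lemma graded_mult:
  assumes "graded V P" "graded V Q"
  shows "graded V (\<lambda>x. P x * Q x)"
  unfolding graded_def coeff_mult
proof (intro allI poly_fun_sum)
  fix k i :: nat assume "i \<in> {..k}"
  then have "i + (k - i) = k" by simp
  then show "poly_fun V k (\<lambda>x. coeff (P x) i * coeff (Q x) (k - i))"
    using poly_fun_mult[of V i "\<lambda>x. coeff (P x) i" "k - i" "\<lambda>x. coeff (Q x) (k - i)"] assms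
    unfolding graded_def by simp
qed

lemma graded_prod: "(\<And>i. i \<in> I \<Longrightarrow> graded V (P i)) \<Longrightarrow> graded V (\<lambda>x. \<Prod>i\<in>I. P i x)"
proof (induction I rule: infinite_finite_induct)
  case (insert i I)
  then show ?case by (auto intro: graded_mult)
qed (auto simp: graded_def intro: poly_fun_const)

lemma graded_linear:
  assumes "v \<in> V"
  shows "graded V (\<lambda>x. [:1, x v - 1:])"
  unfolding graded_def
proof
  fix k :: nat
  consider "k = 0" | "k = 1" | l where "k = Suc (Suc l)"
    by (metis One_nat_def not0_implies_Suc)
  then show "poly_fun V k (\<lambda>x. coeff [:1, x v - 1:] k)"
    using assms by cases (auto intro: poly_fun_const poly_fun_diff poly_fun_var)
qed

section \<open>Taylor coefficients of the logarithm of a polynomial\<close>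

text \<open>
  The \<open>k\<close>-th derivative at \<open>0\<close> of the logarithmic derivative \<open>f' = P'/P\<close>, obtained by differentiating
  \<open>f' P = P'\<close> \<open>k\<close> times with the Leibniz rule and solving for the highest derivative of \<open>f\<close>.
\<close>

fun log_deriv_coeff :: "complex poly \<Rightarrow> nat \<Rightarrow> complex" where
  "log_deriv_coeff P k = (fact (Suc k) * coeff P (Suc k) -
     (\<Sum>i<k. of_nat (k choose i) * log_deriv_coeff P i * (fact (k - i) * coeff P (k - i)))) / coeff P 0"

declare log_deriv_coeff.simps [simp del]

text \<open>
  The recursion is homogeneous: the term with index \<open>i\<close> has degree at most \<open>(i + 1) + (k - i) = k + 1\<close>.
  Dividing by the constant coefficient keeps this polynomial because that coefficient does not vary.
\<close>

lemma poly_fun_log_deriv_coeff: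
  assumes P: "graded V P" and c: "\<And>x. coeff (P x) 0 = c"
  shows "poly_fun V (Suc k) (\<lambda>x. log_deriv_coeff (P x) k)"
proof (induction k rule: less_induct)
  case (less k)
  have P': "poly_fun V j (\<lambda>x. coeff (P x) j)" for j
    using P by (simp add: graded_def)
  have "poly_fun V (Suc k) (\<lambda>x. of_nat (k choose i) * log_deriv_coeff (P x) i * (fact (k - i) * coeff (P x) (k - i)))"
    if "i \<in> {..<k}" for i
  proof -
    have "poly_fun V (Suc i) (\<lambda>x. of_nat (k choose i) * log_deriv_coeff (P x) i)"
      using that less.IH by (intro poly_fun_cmult) auto
    moreover have "poly_fun V (k - i) (\<lambda>x. fact (k - i) * coeff (P x) (k - i))"
      by (intro poly_fun_cmult P')
    moreover have "Suc i + (k - i) = Suc k"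
      using that by simp
    ultimately show ?thesis
      using poly_fun_mult by fastforce
  qed
  then show ?case
    unfolding log_deriv_coeff.simps[of _ k] c divide_inverse
    by (subst mult.commute) (intro poly_fun_cmult poly_fun_diff poly_fun_sum P')
qed

lemma higher_deriv_poly_0: "(deriv ^^ k) (poly P) 0 = fact k * coeff P k" for P :: "complex poly"
proof (induction k arbitrary: P)
  case 0
  then show ?case by (simp add: poly_0_coeff_0)
next
  case (Suc k)
  have "deriv (poly P) = poly (pderiv P)"
    by (intro ext DERIV_imp_deriv poly_DERIV)
  then show ?case
    using Suc[of "pderiv P"] by (simp add: funpow_Suc_right coeff_pderiv mult_ac del: funpow.simps)
qed

lemma higher_deriv_log_poly:
  fixes P :: "complex poly"
  assumes f: "f holomorphic_on S" and S: "open S" "0 \<in> S" and c: "c \<noteq> 0"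
    and log: "\<And>z. z \<in> S \<Longrightarrow> poly P z = c * exp (f z)"
  shows "(deriv ^^ Suc k) f 0 = log_deriv_coeff P k"
proof (induction k rule: less_induct)
  case (less k)
  have f': "deriv f holomorphic_on S"
    using f S(1) by (rule holomorphic_deriv)
  have ode: "deriv f z * poly P z = poly (pderiv P) z" if z: "z \<in> S" for z
  proof -
    have "(f has_field_derivative deriv f z) (at z)"
      using f S(1) z by (rule holomorphic_derivI)
    then have "((\<lambda>z. c * exp (f z)) has_field_derivative c * (exp (f z) * deriv f z)) (at z)"
      by (auto intro!: derivative_eq_intros)
    then have "(poly P has_field_derivative c * (exp (f z) * deriv f z)) (at z)"
      by (rule has_field_derivative_transform_within_open[OF _ S(1) z]) (simp add: log)
    then have "c * (exp (f z) * deriv f z) = poly (pderiv P) z"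
      using poly_DERIV by (rule DERIV_unique)
    then show ?thesis
      using log[OF z] by (simp add: mult_ac)
  qed
  have "(\<Sum>i=0..k. of_nat (k choose i) * (deriv ^^ i) (deriv f) 0 * (deriv ^^ (k - i)) (poly P) 0)
      = (deriv ^^ k) (\<lambda>z. deriv f z * poly P z) 0"
    by (rule higher_deriv_mult[symmetric, OF f' _ S]) (intro holomorphic_intros)
  also have "\<dots> = (deriv ^^ k) (poly (pderiv P)) 0"
  proof (rule higher_deriv_cong_ev)
    show "\<forall>\<^sub>F z in nhds 0. deriv f z * poly P z = poly (pderiv P) z"
      using ode S eventually_nhds by blast
  qed simp
  also have "\<dots> = fact (Suc k) * coeff P (Suc k)"
    by (simp add: higher_deriv_poly_0 coeff_pderiv mult_ac)
  finally have "fact (Suc k) * coeff P (Suc k) =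
      (\<Sum>i<k. of_nat (k choose i) * (deriv ^^ Suc i) f 0 * (fact (k - i) * coeff P (k - i)))
      + (deriv ^^ Suc k) f 0 * coeff P 0"
    by (simp add: atLeast0AtMost lessThan_Suc_atMost[symmetric] higher_deriv_poly_0 funpow_Suc_right del: funpow.simps)
  also have "(\<Sum>i<k. of_nat (k choose i) * (deriv ^^ Suc i) f 0 * (fact (k - i) * coeff P (k - i)))
      = (\<Sum>i<k. of_nat (k choose i) * log_deriv_coeff P i * (fact (k - i) * coeff P (k - i)))"
    using less.IH by (intro sum.cong) auto
  finally have eq: "(deriv ^^ Suc k) f 0 * coeff P 0 = fact (Suc k) * coeff P (Suc k) -
      (\<Sum>i<k. of_nat (k choose i) * log_deriv_coeff P i * (fact (k - i) * coeff P (k - i)))"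
    by (simp only: algebra_simps)
  have "coeff P 0 \<noteq> 0"
    using log[OF S(2)] c by (simp add: poly_0_coeff_0)
  then show ?case
    unfolding log_deriv_coeff.simps[of P k] eq[symmetric] by simp
qed

text \<open>
  By Cauchy's estimate on the circle of radius \<open>\<rho>\<close> the \<open>k\<close>-th Taylor coefficient is at most \<open>B / \<rho>\<^sup>k\<close>; the
  bound is the tail of this geometric series.
\<close>

lemma taylor_error_at_1:
  fixes f :: "complex \<Rightarrow> complex"
  assumes f: "f holomorphic_on cball 0 \<rho>" and \<rho>: "1 < \<rho>"
    and B: "\<And>z. z \<in> cball 0 \<rho> \<Longrightarrow> norm (f z) \<le> B"
  shows "norm (f 1 - (\<Sum>k\<le>m. (deriv ^^ k) f 0 / fact k)) \<le> B / (\<rho> ^ m * (\<rho> - 1))"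
proof -
  have hol: "f holomorphic_on ball 0 \<rho>"
    using f by (rule holomorphic_on_subset) auto
  let ?a = "\<lambda>k. (deriv ^^ k) f 0 / fact k"
  have "?a sums f 1"
    using holomorphic_power_series[OF hol, of 1] \<rho> by simp
  then have "(\<lambda>k. ?a (k + Suc m)) sums (f 1 - (\<Sum>k<Suc m. ?a k))"
    by (rule sums_split_initial_segment)
  moreover have "(\<lambda>k. (B / \<rho> ^ Suc m) * (1 / \<rho>) ^ k) sums ((B / \<rho> ^ Suc m) * (1 / (1 - 1 / \<rho>)))"
    using \<rho> by (intro sums_mult geometric_sums) auto
  moreover have "norm (?a (k + Suc m)) \<le> (B / \<rho> ^ Suc m) * (1 / \<rho>) ^ k" for k
  proof -
    have "norm ((deriv ^^ (k + Suc m)) f 0) \<le> fact (k + Suc m) * B / \<rho> ^ (k + Suc m)"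
      using \<rho> B by (intro Cauchy_inequality hol holomorphic_on_imp_continuous_on f) auto
    then have "norm (?a (k + Suc m)) \<le> B / \<rho> ^ (k + Suc m)"
      by (simp add: norm_divide divide_le_eq mult.commute del: fact_Suc funpow.simps)
    then show ?thesis
      by (simp add: power_add power_one_over field_simps)
  qed
  ultimately have "norm (f 1 - (\<Sum>k<Suc m. ?a k)) \<le> (B / \<rho> ^ Suc m) * (1 / (1 - 1 / \<rho>))"
    by (rule norm_sums_le)
  also have "\<dots> = B / (\<rho> ^ m * (\<rho> - 1))"
    using \<rho> by (simp add: field_simps)
  finally show ?thesis
    by (simp add: lessThan_Suc_atMost)
qed

section \<open>Approximation along rays from the all-ones tensor\<close>

abbreviation ray :: "(nat list \<Rightarrow> complex) \<Rightarrow> complex \<Rightarrow> nat list \<Rightarrow> complex" where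
  "ray Z t \<equiv> \<lambda>x. 1 + t * (Z x - 1)"

definition ray_poly :: "nat \<Rightarrow> nat \<Rightarrow> (nat list \<Rightarrow> complex) \<Rightarrow> complex poly" where
  "ray_poly d n Z = (\<Sum>\<sigma>s | length \<sigma>s = d - 1 \<and> (\<forall>\<sigma>\<in>set \<sigma>s. \<sigma> permutes {1..n}).
     \<Prod>i=1..n. [:1, Z (i # map (\<lambda>\<sigma>. \<sigma> i) \<sigma>s) - 1:])"

lemma poly_ray_poly: "poly (ray_poly d n Z) t = PER d n (ray Z t)"
  by (simp add: ray_poly_def PER_def poly_sum poly_prod)

lemma coeff_ray_poly_0: "coeff (ray_poly d n Z) 0 = PER d n (\<lambda>_. 1)"
  using poly_ray_poly[of d n Z 0] by (simp add: poly_0_coeff_0)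

lemma graded_ray_poly:
  assumes "1 \<le> d"
  shows "graded (tensor_indices d n) (ray_poly d n)"
  unfolding ray_poly_def
proof (intro graded_sum graded_prod graded_linear)
  fix \<sigma>s i
  assume \<sigma>s: "\<sigma>s \<in> {\<sigma>s. length \<sigma>s = d - 1 \<and> (\<forall>\<sigma>\<in>set \<sigma>s. \<sigma> permutes {1..n})}" and i: "i \<in> {1..n}"
  then have "\<sigma> i \<in> {1..n}" if "\<sigma> \<in> set \<sigma>s" for \<sigma>
    using that permutes_in_image[of \<sigma> "{1..n}" i] by blast
  then show "i # map (\<lambda>\<sigma>. \<sigma> i) \<sigma>s \<in> tensor_indices d n"
    using \<sigma>s i assms unfolding tensor_indices_def by auto
qed

lemma near_ones_ray:
  assumes "near_ones d n \<eta> Z" "norm t \<le> \<rho>" "\<rho> * \<eta> \<le> r"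
  shows "near_ones d n r (ray Z t)"
  unfolding near_ones_def
proof
  fix x assume "x \<in> tensor_indices d n"
  then have "norm (1 - Z x) \<le> \<eta>"
    using assms(1) by (simp add: near_ones_def)
  then have "norm t * norm (1 - Z x) \<le> \<rho> * \<eta>"
    using assms(2) order_trans[OF norm_ge_zero assms(2)] by (intro mult_mono) auto
  moreover have "norm (1 - ray Z t x) = norm t * norm (1 - Z x)"
    by (simp add: norm_mult norm_minus_commute)
  ultimately show "norm (1 - ray Z t x) \<le> r"
    using assms(3) by linarith
qed

lemma holomorphic_on_PER_fill_ones_ray: "(\<lambda>t. PER d n (fill_ones i (ray Z t))) holomorphic_on S"
proof -
  have "(\<lambda>t. fill_ones i (ray Z t) x) holomorphic_on S" for x
    unfolding fill_ones_def by (cases "hd x \<le> i") (auto intro!: holomorphic_intros)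
  then show ?thesis
    unfolding PER_def by (intro holomorphic_intros)
qed

context zero_free_angle
begin

text \<open>
  On the disc of radius \<open>\<rho>\<close> the ray stays in the zero-free region, and each of the \<open>n\<close> slice ratios stays
  in the disc on which \<open>C\<close> bounds the logarithm. So the error estimate at \<open>1\<close> applies with \<open>B = n C\<close>.
\<close>

lemma ln_PER_sum_taylor:
  assumes Z: "near_ones d n \<eta> Z" and \<rho>: "1 < \<rho>" "\<rho> * \<eta> \<le> eta_bound d \<theta>"
    and C: "\<And>q. norm (q - 1) \<le> sin (\<theta> / 2) \<Longrightarrow> norm (Ln q) \<le> C"
  shows "norm (ln_PER_sum d n Z -
      (Ln (PER d n (\<lambda>_. 1)) + (\<Sum>k<m. log_deriv_coeff (ray_poly d n Z) k / fact (Suc k))))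
    \<le> real n * C / (\<rho> ^ m * (\<rho> - 1))"
proof -
  define h where "h t = (\<Sum>i=1..n. Ln (slice_ratio d n i (ray Z t)))" for t
  have near: "near_ones d n (eta_bound d \<theta>) (ray Z t)" if "t \<in> cball 0 \<rho>" for t
    using that by (intro near_ones_ray[OF Z _ \<rho>(2)]) simp
  have hol: "h holomorphic_on cball 0 \<rho>"
    unfolding h_def
  proof (intro holomorphic_intros)
    fix i assume i: "i \<in> {1..n}"
    show "slice_ratio d n i (ray Z t) \<notin> \<real>\<^sub>\<le>\<^sub>0" if "t \<in> cball 0 \<rho>" for t
      using i near[OF that] by (intro slice_ratio_not_nonpos) auto
    have "PER d n (fill_ones (i - 1) (ray Z t)) \<noteq> 0" if "t \<in> cball 0 \<rho>" for t
      using near[OF that] eta_bound_pos by (intro PER_nonzero near_ones_fill_ones) auto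
    then show "(\<lambda>t. slice_ratio d n i (ray Z t)) holomorphic_on cball 0 \<rho>"
      unfolding slice_ratio_def by (intro holomorphic_intros holomorphic_on_PER_fill_ones_ray)
  qed
  have bound: "norm (h t) \<le> real n * C" if "t \<in> cball 0 \<rho>" for t
  proof -
    have "norm (h t) \<le> (\<Sum>i=1..n. C)"
      unfolding h_def using near[OF that] by (intro sum_norm_le C slice_ratio_near_1) auto
    then show ?thesis by simp
  qed
  have J: "PER d n (\<lambda>_. 1) \<noteq> 0"
    using PER_ones_pos[of n] by auto
  have log: "poly (ray_poly d n Z) t = PER d n (\<lambda>_. 1) * exp (h t)" if "t \<in> ball 0 \<rho>" for t
  proof -
    have "poly (ray_poly d n Z) t = exp (ln_PER_sum d n (ray Z t))"
      using that by (simp add: poly_ray_poly exp_ln_PER_sum near)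
    also have "\<dots> = PER d n (\<lambda>_. 1) * exp (h t)"
      using J by (simp add: ln_PER_sum_def h_def exp_add)
    finally show ?thesis .
  qed
  have "h holomorphic_on ball 0 \<rho>"
    using hol by (rule holomorphic_on_subset) auto
  then have deriv: "(deriv ^^ Suc k) h 0 = log_deriv_coeff (ray_poly d n Z) k" for k
    using \<rho> J log by (intro higher_deriv_log_poly) auto
  have "h 0 = 0"
    using J by (simp add: h_def slice_ratio_def fill_ones_def)
  then have "(\<Sum>k\<le>m. (deriv ^^ k) h 0 / fact k) = (\<Sum>k<m. log_deriv_coeff (ray_poly d n Z) k / fact (Suc k))"
    unfolding lessThan_Suc_atMost[symmetric] sum.lessThan_Suc_shift by (simp only: deriv) simp
  moreover have "h 1 = ln_PER_sum d n Z - Ln (PER d n (\<lambda>_. 1))"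
    by (simp add: h_def ln_PER_sum_def)
  ultimately show ?thesis
    using taylor_error_at_1[OF hol \<rho>(1) bound, of m] by (simp only: diff_diff_eq)
qed

end

text \<open>
  Taking logarithms, the error bound is at most \<open>\<epsilon>\<close> once \<open>m ln \<rho> \<ge> ln n - ln \<epsilon> + K\<close> with \<open>K\<close> depending on \<open>C\<close> and
  \<open>\<rho>\<close> only. The lower bound \<open>c\<close> lets the additive constants, including the rounding of \<open>m\<close>, be absorbed into
  the factor \<open>\<gamma>\<close>.
\<close>

lemma exists_log_degree:
  fixes \<rho> C c :: real
  assumes \<rho>: "1 < \<rho>" and c: "0 < c"
  shows "\<exists>\<gamma>>0. \<forall>n \<epsilon>. 1 \<le> n \<longrightarrow> 0 < \<epsilon> \<longrightarrow> c \<le> ln (real n) - ln \<epsilon> \<longrightarrow>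
    (\<exists>m::nat. real m \<le> \<gamma> * (ln (real n) - ln \<epsilon>) \<and> real n * C / (\<rho> ^ m * (\<rho> - 1)) \<le> \<epsilon>)"
proof -
  \<comment> \<open>The maximum makes \<open>K\<close> nonnegative.\<close>
  define C' where "C' = max C (\<rho> - 1)"
  define K where "K = ln (C' / (\<rho> - 1))"
  have "1 \<le> C' / (\<rho> - 1)"
    using \<rho> by (simp add: C'_def)
  then have K: "0 \<le> K" "exp K = C' / (\<rho> - 1)"
    by (auto simp: K_def)
  have "0 < ln \<rho>"
    using \<rho> by simp
  define \<gamma> where "\<gamma> = 1 / ln \<rho> + (K / ln \<rho> + 1) / c"
  show ?thesis
  proof (intro exI[of _ \<gamma>] conjI allI impI)
    show "0 < \<gamma>"
      using \<open>0 < ln \<rho>\<close> K(1) c by (auto simp: \<gamma>_def intro!: add_pos_nonneg)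
    fix n :: nat and \<epsilon> :: real
    assume n: "1 \<le> n" and \<epsilon>: "0 < \<epsilon>" and Q: "c \<le> ln (real n) - ln \<epsilon>"
    let ?Q = "ln (real n) - ln \<epsilon>"
    define m where "m = nat \<lceil>(?Q + K) / ln \<rho>\<rceil>"
    have "0 \<le> (?Q + K) / ln \<rho>"
      using Q c K(1) \<open>0 < ln \<rho>\<close> by simp
    then have m: "(?Q + K) / ln \<rho> \<le> real m" "real m \<le> (?Q + K) / ln \<rho> + 1"
      unfolding m_def by linarith+
    have "K / ln \<rho> + 1 \<le> (K / ln \<rho> + 1) / c * ?Q"
      using Q c K(1) \<open>0 < ln \<rho>\<close> mult_left_mono[OF Q, of "(K / ln \<rho> + 1) / c"] by simp
    then have "(?Q + K) / ln \<rho> + 1 \<le> \<gamma> * ?Q"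
      by (simp add: \<gamma>_def add_divide_distrib distrib_right)
    moreover have "real n * C / (\<rho> ^ m * (\<rho> - 1)) \<le> \<epsilon>"
    proof -
      have "?Q + K \<le> real m * ln \<rho>"
        using m(1) \<open>0 < ln \<rho>\<close> by (simp add: divide_le_eq)
      then have "exp (?Q + K) \<le> exp (real m * ln \<rho>)"
        by simp
      moreover have "exp (real m * ln \<rho>) = \<rho> ^ m"
        using \<rho> by (simp add: exp_of_nat_mult)
      moreover have "exp (?Q + K) = real n / \<epsilon> * (C' / (\<rho> - 1))"
        using n \<epsilon> K(2) by (simp add: exp_add exp_diff)
      ultimately have "real n * C' / (\<epsilon> * (\<rho> - 1)) \<le> \<rho> ^ m"
        by simp
      then have "real n * C' \<le> \<epsilon> * (\<rho> ^ m * (\<rho> - 1))"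
        using \<epsilon> \<rho> by (subst (asm) pos_divide_le_eq) (auto simp: mult_ac)
      moreover have "real n * C \<le> real n * C'"
        by (simp add: C'_def mult_left_mono)
      ultimately show ?thesis
        using \<rho> by (simp add: divide_le_eq)
    qed
    ultimately show "\<exists>m::nat. real m \<le> \<gamma> * ?Q \<and> real n * C / (\<rho> ^ m * (\<rho> - 1)) \<le> \<epsilon>"
      using m(2) by (intro exI[of _ m]) linarith
  qed
qed

lemma PER_1: "PER d 1 Z = Z (1 # replicate (d - 1) 1)"
proof -
  have "{\<sigma>s. length \<sigma>s = d - 1 \<and> (\<forall>\<sigma>\<in>set \<sigma>s. \<sigma> permutes {1..1::nat})} = {replicate (d - 1) id}"
    by (auto simp: permutes_sing intro!: replicate_eqI)
  then show ?thesis
    by (simp add: PER_def map_replicate)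
qed

lemma ln_PER_sum_1: "ln_PER_sum d 1 Z = Ln (Z (1 # replicate (d - 1) 1))"
  by (simp add: ln_PER_sum_def slice_ratio_def PER_1[simplified] fill_ones_def)

lemma eta_bound_le_half:
  assumes "2 \<le> d" "0 < \<theta>" "(real d - 1) * \<theta> < 2 * pi / 3"
  shows "eta_bound d \<theta> \<le> 1 / 2"
proof -
  interpret zero_free_angle d \<theta>
    by unfold_locales (use assms in auto)
  have "1 * \<theta> \<le> (real d - 1) * \<theta>"
    using assms by (intro mult_right_mono) auto
  then have "cos ((real d - 1) * \<theta> / 2) \<le> cos (\<theta> / 2)"
    using assms pi_gt_zero by (intro cos_monotone_0_pi_le) (auto simp del: pi_gt_zero)
  then have "eta_bound d \<theta> \<le> sin (\<theta> / 2) * cos (\<theta> / 2)"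
    unfolding eta_bound_def using sin_half_pos by (intro mult_left_mono) auto
  also have "\<dots> = sin \<theta> / 2"
    using sin_double[of "\<theta> / 2"] by simp
  finally show ?thesis
    using sin_le_one[of \<theta>] by linarith
qed

text \<open>
  Both \<open>\<gamma>\<close> and the polynomial are built from one admissible angle \<open>\<theta>0\<close>; they serve every other admissible
  \<open>\<theta>\<close> because all the branches \<open>ln_PER\<close> are given by \<open>ln_PER_sum\<close>. When \<open>n = 1\<close> and \<open>\<epsilon>\<close> is close to \<open>1\<close> the
  degree bound forces a constant polynomial; then \<open>p = 0\<close> works, since the tensor has a single entry and
  \<open>\<bar>ln a\<bar> \<le> 2 \<bar>a - 1\<bar> \<le> 2\<eta> < 1\<close>.
\<close>

theorem theorem3p3:
  fixes d :: nat and \<eta> :: real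
  assumes "d \<ge> 2" and "0 \<le> \<eta>"
  shows "\<exists>\<gamma>>0. \<forall>n::nat. \<forall>\<epsilon>::real. n \<ge> 1 \<longrightarrow> 0 < \<epsilon> \<longrightarrow> \<epsilon> < 1 \<longrightarrow>
    (\<exists>p :: (nat list, complex) mpoly.
       mpoly_vars p \<subseteq> tensor_indices d n \<and>
       real (mpoly_degree p) \<le> \<gamma> * (ln (real n) - ln \<epsilon>) \<and>
       (\<forall>\<theta>::real. 0 < \<theta> \<longrightarrow> (real d - 1) * \<theta> < 2 * pi / 3 \<longrightarrow> \<eta> < eta_bound d \<theta> \<longrightarrow>
         (\<forall>A\<in>tensors d n. (\<forall>is\<in>tensor_indices d n. norm (1 - A is) \<le> \<eta>) \<longrightarrow>
            norm (ln_PER d n (eta_bound d \<theta>) A - mpoly_eval p A) \<le> \<epsilon>)))"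
proof -
  have ln_PER: "ln_PER d n (eta_bound d \<theta>) A = ln_PER_sum d n A"
    if "0 < \<theta>" "(real d - 1) * \<theta> < 2 * pi / 3" "\<eta> < eta_bound d \<theta>"
      "A \<in> tensors d n" "near_ones d n \<eta> A" for \<theta> n A
  proof -
    interpret zero_free_angle d \<theta>
      by unfold_locales (use that assms in auto)
    have "A \<in> tensor_polydisc d n (eta_bound d \<theta>)"
      using that by (force simp: tensor_polydisc_def near_ones_def)
    then show ?thesis
      by (rule ln_PER_eqI[OF is_ln_PER_ln_PER_sum])
  qed
  show ?thesis
  proof (cases "\<exists>\<theta>>0. (real d - 1) * \<theta> < 2 * pi / 3 \<and> \<eta> < eta_bound d \<theta>")
    case False
    have "mpoly_vars (0 :: (nat list, complex) mpoly) = {}" "mpoly_degree (0 :: (nat list, complex) mpoly) = 0"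
      by (auto simp: mpoly_vars_def mpoly_degree_def)
    then show ?thesis
      using False by (intro exI[of _ 1] conjI allI impI exI[of _ 0]) (auto simp: ln_le_zero_iff intro: order_trans)
  next
    case True
    then obtain \<theta>0 where \<theta>0: "0 < \<theta>0" "(real d - 1) * \<theta>0 < 2 * pi / 3" "\<eta> < eta_bound d \<theta>0"
      by blast
    interpret zero_free_angle d \<theta>0
      by unfold_locales (use \<theta>0 assms in auto)
    have \<eta>: "\<eta> < 1 / 2"
      using eta_bound_le_half[OF assms(1) \<theta>0(1,2)] \<theta>0(3) by linarith
    \<comment> \<open>Any \<open>\<rho> > 1\<close> with \<open>\<rho> \<eta> \<le> eta_bound d \<theta>0\<close> serves; this choice avoids dividing by \<open>\<eta>\<close>, which may be \<open>0\<close>.\<close>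
    define \<rho> where "\<rho> = 1 + (eta_bound d \<theta>0 - \<eta>)"
    have "1 < \<rho>"
      using \<theta>0(3) by (simp add: \<rho>_def)
    have "\<eta> * (eta_bound d \<theta>0 - \<eta>) \<le> 1 * (eta_bound d \<theta>0 - \<eta>)"
      using \<eta> \<theta>0(3) by (intro mult_right_mono) auto
    then have \<rho>\<eta>: "\<rho> * \<eta> \<le> eta_bound d \<theta>0"
      by (simp add: \<rho>_def algebra_simps)
    have "compact (Ln ` cball 1 (sin (\<theta>0 / 2)))"
    proof (rule compact_continuous_image[OF continuous_on_Ln])
      fix q :: complex assume "q \<in> cball 1 (sin (\<theta>0 / 2))"
      then have "norm (1 - q) < 1"
        using sin_half_less_1 by (simp add: dist_norm)
      then have "Re q > 0"
        using abs_Re_le_cmod[of "1 - q"] by auto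
      then show "q \<notin> \<real>\<^sub>\<le>\<^sub>0"
        by (auto simp: complex_nonpos_Reals_iff)
    qed simp
    then obtain C where "\<forall>x\<in>Ln ` cball 1 (sin (\<theta>0 / 2)). norm x \<le> C"
      using compact_imp_bounded bounded_iff by blast
    then have C: "norm (Ln q) \<le> C" if "norm (q - 1) \<le> sin (\<theta>0 / 2)" for q
      using that by (auto simp: dist_norm norm_minus_commute)
    \<comment> \<open>The constant polynomial \<open>0\<close> is accurate enough for \<open>n = 1\<close> and \<open>\<epsilon> > \<mu>\<close>. As \<open>\<mu> \<ge> 1/2\<close>, these are
        the only cases with \<open>ln n - ln \<epsilon> < - ln \<mu>\<close>.\<close>
    define \<mu> where "\<mu> = max (2 * \<eta>) (1 / 2)"
    have \<mu>: "1 / 2 \<le> \<mu>" "2 * \<eta> \<le> \<mu>" "\<mu> < 1"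
      using \<eta> by (auto simp: \<mu>_def)
    obtain \<gamma> where "0 < \<gamma>" and \<gamma>: "\<And>n \<epsilon>. 1 \<le> n \<Longrightarrow> 0 < \<epsilon> \<Longrightarrow> - ln \<mu> \<le> ln (real n) - ln \<epsilon> \<Longrightarrow>
        \<exists>m::nat. real m \<le> \<gamma> * (ln (real n) - ln \<epsilon>) \<and> real n * C / (\<rho> ^ m * (\<rho> - 1)) \<le> \<epsilon>"
      using exists_log_degree[OF \<open>1 < \<rho>\<close>, of "- ln \<mu>" C] \<mu> by auto
    show ?thesis
    proof (intro exI[of _ \<gamma>] conjI allI impI)
      fix n :: nat and \<epsilon> :: real
      assume n: "1 \<le> n" and \<epsilon>: "0 < \<epsilon>" "\<epsilon> < 1"
      have "\<exists>k F. poly_fun (tensor_indices d n) k F \<and> real k \<le> \<gamma> * (ln (real n) - ln \<epsilon>) \<and>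
          (\<forall>A. near_ones d n \<eta> A \<longrightarrow> norm (ln_PER_sum d n A - F A) \<le> \<epsilon>)"
      proof (cases "- ln \<mu> \<le> ln (real n) - ln \<epsilon>")
        case True
        then obtain m where m: "real m \<le> \<gamma> * (ln (real n) - ln \<epsilon>)"
            "real n * C / (\<rho> ^ m * (\<rho> - 1)) \<le> \<epsilon>"
          using \<gamma> n \<epsilon>(1) by blast
        define F where "F A = Ln (PER d n (\<lambda>_. 1)) +
            (\<Sum>k<m. log_deriv_coeff (ray_poly d n A) k / fact (Suc k))" for A
        have "poly_fun (tensor_indices d n) m F"
          unfolding F_def
        proof (intro poly_fun_add poly_fun_const poly_fun_sum)
          fix k assume "k \<in> {..<m}"
          have "poly_fun (tensor_indices d n) (Suc k) (\<lambda>A. log_deriv_coeff (ray_poly d n A) k)"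
            using assms by (intro poly_fun_log_deriv_coeff[OF graded_ray_poly coeff_ray_poly_0]) auto
          then have "poly_fun (tensor_indices d n) m (\<lambda>A. log_deriv_coeff (ray_poly d n A) k)"
            by (rule poly_fun_mono) (use \<open>k \<in> {..<m}\<close> in auto)
          then show "poly_fun (tensor_indices d n) m (\<lambda>A. log_deriv_coeff (ray_poly d n A) k / fact (Suc k))"
            using poly_fun_cmult[of _ m _ "1 / fact (Suc k)"] by simp
        qed
        moreover have "norm (ln_PER_sum d n A - F A) \<le> \<epsilon>" if "near_ones d n \<eta> A" for A
          using ln_PER_sum_taylor[OF that \<open>1 < \<rho>\<close> \<rho>\<eta> C, of m] m(2) unfolding F_def by linarith
        ultimately show ?thesis
          using m(1) by blast
      next
        case False
        have "ln (1 / 2) \<le> ln \<mu>"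
          using \<mu> by (intro ln_mono) auto
        moreover have "ln \<epsilon> < 0"
          using \<epsilon> by simp
        ultimately have "ln (real n) < ln 2"
          using False by (simp add: ln_div)
        then have "n = 1"
          using n by simp
        with False have "ln \<mu> < ln \<epsilon>"
          by simp
        then have "\<mu> < \<epsilon>"
          using \<mu> \<epsilon> by simp
        have "norm (ln_PER_sum d n A) \<le> \<epsilon>" if A: "near_ones d n \<eta> A" for A
        proof -
          let ?z = "A (1 # replicate (d - 1) 1)"
          have "1 # replicate (d - 1) 1 \<in> tensor_indices d n"
            using n assms by (auto simp: tensor_indices_def)
          then have z: "norm (?z - 1) \<le> \<eta>"
            using A by (simp add: near_ones_def norm_minus_commute)
          then have "norm (Ln (1 + (?z - 1))) \<le> 2 * norm (?z - 1)"
            using \<eta> by (intro norm_Ln_le) auto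
          then show ?thesis
            using z \<mu>(2) \<open>\<mu> < \<epsilon>\<close> unfolding \<open>n = 1\<close> ln_PER_sum_1 by simp
        qed
        moreover have "0 \<le> \<gamma> * (ln (real n) - ln \<epsilon>)"
          using \<open>0 < \<gamma>\<close> \<open>n = 1\<close> \<epsilon> by (intro mult_nonneg_nonneg) auto
        ultimately show ?thesis
          by (intro exI[of _ 0] exI[of _ "\<lambda>_. 0"]) (auto intro: poly_fun_const)
      qed
      then obtain k F where kF: "poly_fun (tensor_indices d n) k F" "real k \<le> \<gamma> * (ln (real n) - ln \<epsilon>)"
          "\<And>A. near_ones d n \<eta> A \<Longrightarrow> norm (ln_PER_sum d n A - F A) \<le> \<epsilon>"
        by blast
      obtain p where p: "mpoly_vars p \<subseteq> tensor_indices d n" "mpoly_degree p \<le> k" "\<And>A. mpoly_eval p A = F A"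
        using kF(1) by (rule poly_funE) (rule that)
      have "real (mpoly_degree p) \<le> \<gamma> * (ln (real n) - ln \<epsilon>)"
        using p(2) kF(2) by linarith
      then show "\<exists>p :: (nat list, complex) mpoly.
         mpoly_vars p \<subseteq> tensor_indices d n \<and>
         real (mpoly_degree p) \<le> \<gamma> * (ln (real n) - ln \<epsilon>) \<and>
         (\<forall>\<theta>::real. 0 < \<theta> \<longrightarrow> (real d - 1) * \<theta> < 2 * pi / 3 \<longrightarrow> \<eta> < eta_bound d \<theta> \<longrightarrow>
           (\<forall>A\<in>tensors d n. (\<forall>is\<in>tensor_indices d n. norm (1 - A is) \<le> \<eta>) \<longrightarrow>
              norm (ln_PER d n (eta_bound d \<theta>) A - mpoly_eval p A) \<le> \<epsilon>))"
        using p kF(3) ln_PER by (intro exI[of _ p]) (auto simp: near_ones_def)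
    qed fact
  qed
qed

end
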